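(* Let $n\ge 1$ be an integer, let $\omega$ be a complex number with $\omega^{2n}=1$, and let $\sigma$ be a square root of $\omega$. Consider closed planar string diagrams (diagrams with empty boundary) built from unoriented $\theta$-strands, unoriented $\rho$-strands, trivalent $\rho$-vertices, and copies of the generators $U$ and $U^*$, modulo the relations (R1)–(R5) listed in the context. These relations are sufficient to evaluate all closed diagrams: modulo the relations, every such closed diagram is equal to a scalar multiple of the empty diagram.
   Context: Let $\tau=\frac{1+\sqrt5}{2}$. Work in the strict pivotal $*$-category generated by two symmetrically self-dual objects $\theta,\rho$ (drawn as unoriented strands of two colours, which may not cross each other), a trivalent vertex $m:\rho\otimes\rho\to\rho$, and morphisms $U:(\rho\theta)^n\to(\theta\rho)^n$ and $U^*:(\theta\rho)^n\to(\rho\theta)^n$. Tensor signs are omitted; $\mathrm{ev}_x: x\,x\to 1$ and $\mathrm{coev}_x:1\to x\,x$ denote cap and cup for a self-dual object $x$. All relations are imposed locally, together with their adjoints. Put $\zeta=(\theta\rho)^{n-1}\theta$ (a self-dual word), so that $U:\rho\zeta\to\zeta\rho$, and $\xi=\rho(\theta\rho)^{n-1}$, so that $U:\xi\theta\to\theta\xi$. Rotations: $\mathcal F(U)=(\mathrm{id}_{\rho\zeta}\otimes \mathrm{ev}_\rho)(\mathrm{id}_\rho\otimes U\otimes \mathrm{id}_\rho)(\mathrm{coev}_\rho\otimes \mathrm{id}_{\zeta\rho}):\zeta\rho\to\rho\zeta$ and $\mathcal F^{-1}(U)=(\mathrm{ev}_\theta\otimes \mathrm{id}_{\xi\theta})(\mathrm{id}_\theta\otimes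 U\otimes \mathrm{id}_\theta)(\mathrm{id}_{\theta\xi}\otimes \mathrm{coev}_\theta):\theta\xi\to\xi\theta$. Auxiliary morphisms: $Y:\rho\to\rho\rho$ and $t:\rho\rho\rho\to 1$ are the trivalent vertex with its legs bent; $u=\mathrm{ev}\circ(U\otimes \mathrm{id}_{\rho\zeta}):\rho\zeta\rho\zeta\to1$, where $\mathrm{ev}:(\zeta\rho)(\rho\zeta)\to1$ is the nested cap; $v=\mathrm{ev}\circ(U^*\otimes \mathrm{id}_{\zeta\rho}):\zeta\rho\zeta\rho\to 1$, where $\mathrm{ev}:(\rho\zeta)(\zeta\rho)\to1$ is the nested cap; $u':\zeta\rho\zeta\to\rho$ is obtained from $u$ by bending its first (leftmost) $\rho$ leg to the top; $v':\zeta\rho\zeta\to\rho$ is obtained from $v$ by bending its last (rightmost) $\rho$ leg to the top; $M=(\mathrm{id}_\rho\otimes \mathrm{coev}_\zeta\otimes \mathrm{id}_\rho)\circ Y:\rho\to\rho\zeta\zeta\rho$. Relations: (R1) ($\theta$-strands) A closed $\theta$-loop equals $1$, and $\mathrm{id}_{\theta\theta}=\mathrm{coev}_\theta\,\mathrm{ev}_\theta$. (R2) ($\rho$-strands) The trivalent vertex is invariant under rotation, and its adjoint is the reflected trivalent vertex $Y=m^*$; $m\,m^*=\mathrm{id}_\rho$; a closed $\rho$-loop and the closed theta graph (two trivalent vertices joined by three strands) both equal $\tau$; a trivalent vertex with two of its legs joined is $0$; and $\mathrm{id}_{\rho\rho}=\frac1\tau\,\mathrm{coev}_\rho\,\mathrm{ev}_\rho+m^*m$.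 (R3) (unitarity) $U^*U=\mathrm{id}_{\rho\zeta}$ and $UU^*=\mathrm{id}_{\zeta\rho}$. (R4) (rotation) $\mathcal F^{-1}(U)=U^*=\omega^{-1}\mathcal F(U)$. (R5) (jellyfish relations) (1) $\mathrm{ev}_\theta\circ(\mathrm{id}_\theta\otimes u\otimes \mathrm{id}_\theta)=v\otimes \mathrm{ev}_\theta$ as morphisms $\theta(\rho\theta)^{2n}\theta=(\theta\rho)^{2n}\theta\theta\to1$; (2) $t\circ(\mathrm{id}_\rho\otimes u'\otimes \mathrm{id}_\rho)=\omega\, t\circ(\mathrm{id}_\rho\otimes v'\otimes \mathrm{id}_\rho)=\sigma^{-1}(u\otimes v)\circ(\mathrm{id}_{\rho\zeta}\otimes M\otimes \mathrm{id}_{\zeta\rho})$ as morphisms $\rho\zeta\rho\zeta\rho\to1$; (3) $\mathrm{ev}_\rho\circ(\mathrm{id}_\rho\otimes u\otimes \mathrm{id}_\rho)=\frac{\omega}{\tau}\,\mathrm{ev}_\rho\otimes v+\sigma^{-1}(u\otimes v)\circ(m\otimes \mathrm{id}_\zeta\otimes M\otimes \mathrm{id}_{\zeta\rho})$ as morphisms $\rho\rho\zeta\rho\zeta\rho\to1$. *)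

theory Defs
  imports Complex_Main
begin

section \<open>Formal morphisms\<close>

datatype colour = Theta | Rho

type_synonym obj = "colour list"

text \<open>
  Objects of the strict monoidal category are words in the two self-dual colours; the tensor
  product is concatenation, the unit is the empty word and the dual of a word is its reversal.
  Morphisms are formal expressions, later identified by the relation \<open>mor_eq\<close>.
  \<open>f \<odot> g\<close> is composition (first \<open>g\<close>, then \<open>f\<close>), \<open>f \<otimes> g\<close> is horizontal juxtaposition.
  Crossings of strands are simply not available.  \<open>GenMStar\<close> and \<open>GenUStar\<close> are the formal adjoints of
  the generators \<open>GenM\<close> (the trivalent vertex \<open>m\<close>) and \<open>GenU\<close>.
\<close>

datatype mor =
    Id obj
  | Cap colour
  | Cup colour
  | GenM
  | GenMStar
  | GenU
  | GenUStar
  | Comp mor mor (infixr \<open>\<odot>\<close> 60)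
  | Tens mor mor (infixr \<open>\<otimes>\<close> 70)
  | Zero obj obj
  | Plus mor mor (infixr \<open>\<oplus>\<close> 55)
  | Scale complex mor (infixr \<open>\<bullet>\<close> 57)

definition tr :: obj where "tr = [Theta, Rho]"

definition rt :: obj where "rt = [Rho, Theta]"

definition pow :: "obj \<Rightarrow> nat \<Rightarrow> obj" where
  "pow w k = concat (replicate k w)"

primrec src :: "nat \<Rightarrow> mor \<Rightarrow> obj" where
  "src n (Id w) = w"
| "src n (Cap x) = [x, x]"
| "src n (Cup x) = []"
| "src n GenM = [Rho, Rho]"
| "src n GenMStar = [Rho]"
| "src n GenU = pow rt n"
| "src n GenUStar = pow tr n"
| "src n (f \<odot> g) = src n g"
| "src n (f \<otimes> g) = src n f @ src n g"
| "src n (Zero a b) = a"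
| "src n (f \<oplus> g) = src n f"
| "src n (c \<bullet> f) = src n f"

primrec tgt :: "nat \<Rightarrow> mor \<Rightarrow> obj" where
  "tgt n (Id w) = w"
| "tgt n (Cap x) = []"
| "tgt n (Cup x) = [x, x]"
| "tgt n GenM = [Rho]"
| "tgt n GenMStar = [Rho, Rho]"
| "tgt n GenU = pow tr n"
| "tgt n GenUStar = pow rt n"
| "tgt n (f \<odot> g) = tgt n f"
| "tgt n (f \<otimes> g) = tgt n f @ tgt n g"
| "tgt n (Zero a b) = b"
| "tgt n (f \<oplus> g) = tgt n f"
| "tgt n (c \<bullet> f) = tgt n f"

primrec well_typed :: "nat \<Rightarrow> mor \<Rightarrow> bool" where
  "well_typed n (Id w) = True"
| "well_typed n (Cap x) = True"
| "well_typed n (Cup x) = True"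
| "well_typed n GenM = True"
| "well_typed n GenMStar = True"
| "well_typed n GenU = True"
| "well_typed n GenUStar = True"
| "well_typed n (f \<odot> g) = (well_typed n f \<and> well_typed n g \<and> src n f = tgt n g)"
| "well_typed n (f \<otimes> g) = (well_typed n f \<and> well_typed n g)"
| "well_typed n (Zero a b) = True"
| "well_typed n (f \<oplus> g) =
    (well_typed n f \<and> well_typed n g \<and> src n f = src n g \<and> tgt n f = tgt n g)"
| "well_typed n (c \<bullet> f) = well_typed n f"

definition hom :: "nat \<Rightarrow> obj \<Rightarrow> obj \<Rightarrow> mor set" where
  "hom n a b = {f. well_typed n f \<and> src n f = a \<and> tgt n f = b}"

text \<open>
  A string diagram is an expression without linear structure: cutting a planar diagram in general
  position into elementary pieces presents it by identities, caps, cups, vertices and copies of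
  \<open>GenU\<close> and \<open>GenUStar\<close>, using only \<open>\<odot>\<close> and \<open>\<otimes>\<close>.
\<close>

primrec is_diagram :: "mor \<Rightarrow> bool" where
  "is_diagram (Id w) = True"
| "is_diagram (Cap x) = True"
| "is_diagram (Cup x) = True"
| "is_diagram GenM = True"
| "is_diagram GenMStar = True"
| "is_diagram GenU = True"
| "is_diagram GenUStar = True"
| "is_diagram (f \<odot> g) = (is_diagram f \<and> is_diagram g)"
| "is_diagram (f \<otimes> g) = (is_diagram f \<and> is_diagram g)"
| "is_diagram (Zero a b) = False"
| "is_diagram (f \<oplus> g) = False"
| "is_diagram (c \<bullet> f) = False"

definition closed_diagram :: "nat \<Rightarrow> mor \<Rightarrow> bool" where
  "closed_diagram n d \<longleftrightarrow> is_diagram d \<and> d \<in> hom n [] []"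

definition empty_diagram :: mor where
  "empty_diagram = Id []"

primrec adj :: "mor \<Rightarrow> mor" where
  "adj (Id w) = Id w"
| "adj (Cap x) = Cup x"
| "adj (Cup x) = Cap x"
| "adj GenM = GenMStar"
| "adj GenMStar = GenM"
| "adj GenU = GenUStar"
| "adj GenUStar = GenU"
| "adj (f \<odot> g) = adj g \<odot> adj f"
| "adj (f \<otimes> g) = adj f \<otimes> adj g"
| "adj (Zero a b) = Zero b a"
| "adj (f \<oplus> g) = adj f \<oplus> adj g"
| "adj (c \<bullet> f) = cnj c \<bullet> adj f"


section \<open>Nested caps and cups, duals\<close>

text \<open>\<open>ev w : w @ rev w \<rightarrow> 1\<close> and \<open>coev w : 1 \<rightarrow> w @ rev w\<close>.\<close>

primrec ev :: "obj \<Rightarrow> mor" where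
  "ev [] = Id []"
| "ev (x # w) = Cap x \<odot> (Id [x] \<otimes> ev w \<otimes> Id [x])"

primrec coev :: "obj \<Rightarrow> mor" where
  "coev [] = Id []"
| "coev (x # w) = (Id [x] \<otimes> coev w \<otimes> Id [x]) \<odot> Cup x"

text \<open>The two duals \<open>rev b \<rightarrow> rev a\<close> of \<open>f : a \<rightarrow> b\<close>, i.e. \<open>f\<close> turned by a half turn in either sense.\<close>

definition left_dual :: "obj \<Rightarrow> obj \<Rightarrow> mor \<Rightarrow> mor" where
  "left_dual a b f =
     (ev (rev b) \<otimes> Id (rev a)) \<odot> (Id (rev b) \<otimes> f \<otimes> Id (rev a)) \<odot> (Id (rev b) \<otimes> coev a)"

definition right_dual :: "obj \<Rightarrow> obj \<Rightarrow> mor \<Rightarrow> mor" where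
  "right_dual a b f =
     (Id (rev a) \<otimes> ev b) \<odot> (Id (rev a) \<otimes> f \<otimes> Id (rev b)) \<odot> (coev (rev a) \<otimes> Id (rev b))"


section \<open>Auxiliary morphisms\<close>

definition \<tau> :: complex where
  "\<tau> = of_real ((1 + sqrt 5) / 2)"

definition \<zeta> :: "nat \<Rightarrow> obj" where
  "\<zeta> n = pow tr (n - 1) @ [Theta]"

definition \<xi> :: "nat \<Rightarrow> obj" where
  "\<xi> n = [Rho] @ pow tr (n - 1)"

definition rotU :: "nat \<Rightarrow> mor" where
  "rotU n = (Id ([Rho] @ \<zeta> n) \<otimes> Cap Rho) \<odot> (Id [Rho] \<otimes> GenU \<otimes> Id [Rho])
             \<odot> (Cup Rho \<otimes> Id (\<zeta> n @ [Rho]))"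

definition rotU_inv :: "nat \<Rightarrow> mor" where
  "rotU_inv n = (Cap Theta \<otimes> Id (\<xi> n @ [Theta])) \<odot> (Id [Theta] \<otimes> GenU \<otimes> Id [Theta])
             \<odot> (Id ([Theta] @ \<xi> n) \<otimes> Cup Theta)"

definition rotM :: mor where
  "rotM = (Id [Rho] \<otimes> Cap Rho) \<odot> (Id [Rho] \<otimes> GenM \<otimes> Id [Rho]) \<odot> (Cup Rho \<otimes> Id [Rho, Rho])"

definition Y_mor :: mor where
  "Y_mor = (Id [Rho] \<otimes> GenM) \<odot> (Cup Rho \<otimes> Id [Rho])"

definition t_mor :: mor where
  "t_mor = Cap Rho \<odot> (GenM \<otimes> Id [Rho])"

definition u_mor :: "nat \<Rightarrow> mor" where
  "u_mor n = ev (\<zeta> n @ [Rho]) \<odot> (GenU \<otimes> Id ([Rho] @ \<zeta> n))"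

definition v_mor :: "nat \<Rightarrow> mor" where
  "v_mor n = ev ([Rho] @ \<zeta> n) \<odot> (GenUStar \<otimes> Id (\<zeta> n @ [Rho]))"

definition u_mor' :: "nat \<Rightarrow> mor" where
  "u_mor' n = (Id [Rho] \<otimes> u_mor n) \<odot> (Cup Rho \<otimes> Id (\<zeta> n @ [Rho] @ \<zeta> n))"

definition v_mor' :: "nat \<Rightarrow> mor" where
  "v_mor' n = (v_mor n \<otimes> Id [Rho]) \<odot> (Id (\<zeta> n @ [Rho] @ \<zeta> n) \<otimes> Cup Rho)"

definition M_mor :: "nat \<Rightarrow> mor" where
  "M_mor n = (Id [Rho] \<otimes> coev (\<zeta> n) \<otimes> Id [Rho]) \<odot> Y_mor"


section \<open>Relations\<close>

inductive skein :: "nat \<Rightarrow> complex \<Rightarrow> complex \<Rightarrow> mor \<Rightarrow> mor \<Rightarrow> bool"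
  for n :: nat and \<omega> \<sigma> :: complex
where
  theta_loop: "skein n \<omega> \<sigma> (Cap Theta \<odot> Cup Theta) (Id [])"
| theta_cut: "skein n \<omega> \<sigma> (Id [Theta, Theta]) (Cup Theta \<odot> Cap Theta)"
| vertex_rotation: "skein n \<omega> \<sigma> rotM GenM"
| vertex_adjoint: "skein n \<omega> \<sigma> GenMStar Y_mor"
| bigon: "skein n \<omega> \<sigma> (GenM \<odot> GenMStar) (Id [Rho])"
| rho_loop: "skein n \<omega> \<sigma> (Cap Rho \<odot> Cup Rho) (\<tau> \<bullet> Id [])"
| theta_graph: "skein n \<omega> \<sigma> (t_mor \<odot> adj t_mor) (\<tau> \<bullet> Id [])"
| tadpole: "skein n \<omega> \<sigma> (GenM \<odot> Cup Rho) (Zero [] [Rho])"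
| rho_fusion: "skein n \<omega> \<sigma> (Id [Rho, Rho]) ((1 / \<tau>) \<bullet> (Cup Rho \<odot> Cap Rho) \<oplus> GenMStar \<odot> GenM)"
| unitary_left: "skein n \<omega> \<sigma> (GenUStar \<odot> GenU) (Id ([Rho] @ \<zeta> n))"
| unitary_right: "skein n \<omega> \<sigma> (GenU \<odot> GenUStar) (Id (\<zeta> n @ [Rho]))"
| rotation_inv: "skein n \<omega> \<sigma> (rotU_inv n) GenUStar"
| rotation: "skein n \<omega> \<sigma> GenUStar (inverse \<omega> \<bullet> rotU n)"
| jellyfish_theta:
    "skein n \<omega> \<sigma> (Cap Theta \<odot> (Id [Theta] \<otimes> u_mor n \<otimes> Id [Theta])) (v_mor n \<otimes> Cap Theta)"
| jellyfish_vertex_uv: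
    "skein n \<omega> \<sigma>
       (t_mor \<odot> (Id [Rho] \<otimes> u_mor' n \<otimes> Id [Rho]))
       (\<omega> \<bullet> (t_mor \<odot> (Id [Rho] \<otimes> v_mor' n \<otimes> Id [Rho])))"
| jellyfish_vertex:
    "skein n \<omega> \<sigma>
       (\<omega> \<bullet> (t_mor \<odot> (Id [Rho] \<otimes> v_mor' n \<otimes> Id [Rho])))
       (inverse \<sigma> \<bullet> ((u_mor n \<otimes> v_mor n) \<odot> (Id ([Rho] @ \<zeta> n) \<otimes> M_mor n \<otimes> Id (\<zeta> n @ [Rho]))))"
| jellyfish_rho:
    "skein n \<omega> \<sigma>
       (Cap Rho \<odot> (Id [Rho] \<otimes> u_mor n \<otimes> Id [Rho]))
       ((\<omega> / \<tau>) \<bullet> (Cap Rho \<otimes> v_mor n)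
        \<oplus> inverse \<sigma> \<bullet> ((u_mor n \<otimes> v_mor n) \<odot> (GenM \<otimes> Id (\<zeta> n) \<otimes> M_mor n \<otimes> Id (\<zeta> n @ [Rho]))))"

text \<open>
  \<open>mor_eq n \<omega> \<sigma>\<close> is the least congruence on well-typed expressions that makes them a complex-linear
  strict pivotal \<open>*\<close>-category and contains \<open>skein n \<omega> \<sigma>\<close>.  The rule \<open>adj_cong\<close> adds the adjoint of
  every relation.  Applied to all \<open>f\<close>, the rule \<open>pivotal\<close> (left and right duals agree) amounts,
  together with the zigzag rules, to invariance under planar isotopy.
\<close>

inductive mor_eq :: "nat \<Rightarrow> complex \<Rightarrow> complex \<Rightarrow> mor \<Rightarrow> mor \<Rightarrow> bool"
  for n :: nat and \<omega> \<sigma> :: complex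
where
  of_skein: "skein n \<omega> \<sigma> f g \<Longrightarrow> mor_eq n \<omega> \<sigma> f g"
| mor_refl: "f \<in> hom n a b \<Longrightarrow> mor_eq n \<omega> \<sigma> f f"
| mor_sym: "mor_eq n \<omega> \<sigma> f g \<Longrightarrow> mor_eq n \<omega> \<sigma> g f"
| mor_trans: "mor_eq n \<omega> \<sigma> f g \<Longrightarrow> mor_eq n \<omega> \<sigma> g h \<Longrightarrow> mor_eq n \<omega> \<sigma> f h"
| comp_cong: "mor_eq n \<omega> \<sigma> f f' \<Longrightarrow> mor_eq n \<omega> \<sigma> g g' \<Longrightarrow> f \<in> hom n b c \<Longrightarrow> g \<in> hom n a b \<Longrightarrow>
    mor_eq n \<omega> \<sigma> (f \<odot> g) (f' \<odot> g')"
| tens_cong: "mor_eq n \<omega> \<sigma> f f' \<Longrightarrow> mor_eq n \<omega> \<sigma> g g' \<Longrightarrow> mor_eq n \<omega> \<sigma> (f \<otimes> g) (f' \<otimes> g')"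
| plus_cong: "mor_eq n \<omega> \<sigma> f f' \<Longrightarrow> mor_eq n \<omega> \<sigma> g g' \<Longrightarrow> f \<in> hom n a b \<Longrightarrow> g \<in> hom n a b \<Longrightarrow>
    mor_eq n \<omega> \<sigma> (f \<oplus> g) (f' \<oplus> g')"
| scale_cong: "mor_eq n \<omega> \<sigma> f f' \<Longrightarrow> mor_eq n \<omega> \<sigma> (c \<bullet> f) (c \<bullet> f')"
| adj_cong: "mor_eq n \<omega> \<sigma> f g \<Longrightarrow> mor_eq n \<omega> \<sigma> (adj f) (adj g)"

\<comment> \<open>category\<close>
| comp_assoc: "f \<in> hom n c d \<Longrightarrow> g \<in> hom n b c \<Longrightarrow> h \<in> hom n a b \<Longrightarrow>
    mor_eq n \<omega> \<sigma> ((f \<odot> g) \<odot> h) (f \<odot> g \<odot> h)"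
| id_comp: "f \<in> hom n a b \<Longrightarrow> mor_eq n \<omega> \<sigma> (Id b \<odot> f) f"
| comp_id: "f \<in> hom n a b \<Longrightarrow> mor_eq n \<omega> \<sigma> (f \<odot> Id a) f"

\<comment> \<open>strict monoidal structure\<close>
| tens_assoc: "f \<in> hom n a b \<Longrightarrow> g \<in> hom n c d \<Longrightarrow> h \<in> hom n e e' \<Longrightarrow>
    mor_eq n \<omega> \<sigma> ((f \<otimes> g) \<otimes> h) (f \<otimes> g \<otimes> h)"
| unit_tens: "f \<in> hom n a b \<Longrightarrow> mor_eq n \<omega> \<sigma> (Id [] \<otimes> f) f"
| tens_unit: "f \<in> hom n a b \<Longrightarrow> mor_eq n \<omega> \<sigma> (f \<otimes> Id []) f"
| tens_id: "mor_eq n \<omega> \<sigma> (Id a \<otimes> Id b) (Id (a @ b))"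
| interchange: "f \<in> hom n b c \<Longrightarrow> f' \<in> hom n a b \<Longrightarrow> g \<in> hom n b' c' \<Longrightarrow> g' \<in> hom n a' b' \<Longrightarrow>
    mor_eq n \<omega> \<sigma> ((f \<odot> f') \<otimes> (g \<odot> g')) ((f \<otimes> g) \<odot> (f' \<otimes> g'))"

\<comment> \<open>complex vector space structure on hom-spaces\<close>
| plus_assoc: "f \<in> hom n a b \<Longrightarrow> g \<in> hom n a b \<Longrightarrow> h \<in> hom n a b \<Longrightarrow>
    mor_eq n \<omega> \<sigma> ((f \<oplus> g) \<oplus> h) (f \<oplus> g \<oplus> h)"
| plus_comm: "f \<in> hom n a b \<Longrightarrow> g \<in> hom n a b \<Longrightarrow> mor_eq n \<omega> \<sigma> (f \<oplus> g) (g \<oplus> f)"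
| zero_plus: "f \<in> hom n a b \<Longrightarrow> mor_eq n \<omega> \<sigma> (Zero a b \<oplus> f) f"
| scale_zero: "f \<in> hom n a b \<Longrightarrow> mor_eq n \<omega> \<sigma> (0 \<bullet> f) (Zero a b)"
| scale_one: "f \<in> hom n a b \<Longrightarrow> mor_eq n \<omega> \<sigma> (1 \<bullet> f) f"
| scale_scale: "f \<in> hom n a b \<Longrightarrow> mor_eq n \<omega> \<sigma> (c \<bullet> c' \<bullet> f) ((c * c') \<bullet> f)"
| scale_add: "f \<in> hom n a b \<Longrightarrow> mor_eq n \<omega> \<sigma> ((c + c') \<bullet> f) (c \<bullet> f \<oplus> c' \<bullet> f)"
| scale_plus: "f \<in> hom n a b \<Longrightarrow> g \<in> hom n a b \<Longrightarrow>
    mor_eq n \<omega> \<sigma> (c \<bullet> (f \<oplus> g)) (c \<bullet> f \<oplus> c \<bullet> g)"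

\<comment> \<open>bilinearity of composition and tensor product\<close>
| comp_plus_left: "f \<in> hom n b c \<Longrightarrow> f' \<in> hom n b c \<Longrightarrow> g \<in> hom n a b \<Longrightarrow>
    mor_eq n \<omega> \<sigma> ((f \<oplus> f') \<odot> g) (f \<odot> g \<oplus> f' \<odot> g)"
| comp_plus_right: "f \<in> hom n b c \<Longrightarrow> g \<in> hom n a b \<Longrightarrow> g' \<in> hom n a b \<Longrightarrow>
    mor_eq n \<omega> \<sigma> (f \<odot> (g \<oplus> g')) (f \<odot> g \<oplus> f \<odot> g')"
| comp_scale_left: "f \<in> hom n b c \<Longrightarrow> g \<in> hom n a b \<Longrightarrow>
    mor_eq n \<omega> \<sigma> ((k \<bullet> f) \<odot> g) (k \<bullet> (f \<odot> g))"
| comp_scale_right: "f \<in> hom n b c \<Longrightarrow> g \<in> hom n a b \<Longrightarrow>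
    mor_eq n \<omega> \<sigma> (f \<odot> (k \<bullet> g)) (k \<bullet> (f \<odot> g))"
| tens_plus_left: "f \<in> hom n a b \<Longrightarrow> f' \<in> hom n a b \<Longrightarrow> g \<in> hom n c d \<Longrightarrow>
    mor_eq n \<omega> \<sigma> ((f \<oplus> f') \<otimes> g) (f \<otimes> g \<oplus> f' \<otimes> g)"
| tens_plus_right: "f \<in> hom n a b \<Longrightarrow> g \<in> hom n c d \<Longrightarrow> g' \<in> hom n c d \<Longrightarrow>
    mor_eq n \<omega> \<sigma> (f \<otimes> (g \<oplus> g')) (f \<otimes> g \<oplus> f \<otimes> g')"
| tens_scale_left: "f \<in> hom n a b \<Longrightarrow> g \<in> hom n c d \<Longrightarrow>
    mor_eq n \<omega> \<sigma> ((k \<bullet> f) \<otimes> g) (k \<bullet> (f \<otimes> g))"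
| tens_scale_right: "f \<in> hom n a b \<Longrightarrow> g \<in> hom n c d \<Longrightarrow>
    mor_eq n \<omega> \<sigma> (f \<otimes> (k \<bullet> g)) (k \<bullet> (f \<otimes> g))"

\<comment> \<open>pivotal structure\<close>
| zigzag_left: "mor_eq n \<omega> \<sigma> ((Cap x \<otimes> Id [x]) \<odot> (Id [x] \<otimes> Cup x)) (Id [x])"
| zigzag_right: "mor_eq n \<omega> \<sigma> ((Id [x] \<otimes> Cap x) \<odot> (Cup x \<otimes> Id [x])) (Id [x])"
| pivotal: "f \<in> hom n a b \<Longrightarrow> mor_eq n \<omega> \<sigma> (left_dual a b f) (right_dual a b f)"


section \<open>All relations are between morphisms with equal source and target\<close>

lemma pow_0 [simp]: "pow w 0 = []"
  and pow_Suc: "pow w (Suc k) = w @ pow w k"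
  by (simp_all add: pow_def)

lemma pow_rt_shift: "[Rho] @ pow tr k @ [Theta] = pow rt (Suc k)"
  by (induction k) (simp_all add: pow_Suc rt_def tr_def)

lemma pow_tr_Suc': "pow tr k @ [Theta, Rho] = pow tr (Suc k)"
  by (induction k) (simp_all add: pow_Suc tr_def)

lemma rho_zeta: "n \<ge> 1 \<Longrightarrow> [Rho] @ \<zeta> n = pow rt n"
  and zeta_rho: "n \<ge> 1 \<Longrightarrow> \<zeta> n @ [Rho] = pow tr n"
  and xi_theta: "n \<ge> 1 \<Longrightarrow> \<xi> n @ [Theta] = pow rt n"
  and theta_xi: "n \<ge> 1 \<Longrightarrow> [Theta] @ \<xi> n = pow tr n"
  using pow_rt_shift[of "n - 1"] pow_tr_Suc'[of "n - 1"] pow_Suc[of tr "n - 1"]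
  by (simp_all add: \<zeta>_def \<xi>_def tr_def)

lemma rev_pow_tr: "rev (pow tr k) = pow rt k"
proof (induction k)
  case (Suc k)
  have "rev (pow tr (Suc k)) = rev (pow tr k @ [Theta, Rho])"
    by (simp only: pow_tr_Suc')
  then show ?case using Suc by (simp add: pow_Suc rt_def)
qed simp

lemma theta_pow_rt: "Theta # pow rt k = pow tr k @ [Theta]"
  by (induction k) (simp_all add: pow_Suc rt_def tr_def)

lemma rev_zeta: "rev (\<zeta> n) = \<zeta> n"
  by (simp add: \<zeta>_def rev_pow_tr theta_pow_rt)

lemma ev_hom: "ev w \<in> hom n (w @ rev w) []"
  and coev_hom: "coev w \<in> hom n [] (w @ rev w)"
  by (induction w) (simp_all add: hom_def)

lemma adj_hom: "f \<in> hom n a b \<Longrightarrow> adj f \<in> hom n b a"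
proof -
  have "src n (adj f) = tgt n f \<and> tgt n (adj f) = src n f \<and> (well_typed n f \<longrightarrow> well_typed n (adj f))"
    by (induction f) auto
  then show "f \<in> hom n a b \<Longrightarrow> adj f \<in> hom n b a" by (auto simp: hom_def)
qed

lemma skein_hom:
  assumes "n \<ge> 1" and "skein n \<omega> \<sigma> f g"
  shows "\<exists>a b. f \<in> hom n a b \<and> g \<in> hom n a b"
proof -
  note word_simps = rho_zeta[OF assms(1), simplified] zeta_rho[OF assms(1), simplified]
    xi_theta[OF assms(1), simplified] theta_xi[OF assms(1), simplified]
  have ev: "well_typed n (ev w)" "src n (ev w) = w @ rev w" "tgt n (ev w) = []" for w
    using ev_hom[of w n] by (simp_all add: hom_def)
  have coev: "well_typed n (coev w)" "src n (coev w) = []" "tgt n (coev w) = w @ rev w" for w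
    using coev_hom[of w n] by (simp_all add: hom_def)
  have rt: "pow rt n = Rho # \<zeta> n" and tr: "pow tr n = \<zeta> n @ [Rho]"
    and xi: "\<xi> n @ [Theta] = Rho # \<zeta> n" "Theta # \<xi> n = \<zeta> n @ [Rho]"
    by (simp_all add: word_simps)
  have step: "Theta # Rho # \<zeta> n = \<zeta> n @ [Rho, Theta]"
    using theta_pow_rt[of n] by (simp add: rt tr)
  have shift: "\<xi> n @ Theta # w = Rho # \<zeta> n @ w" "Theta # \<xi> n @ w = \<zeta> n @ Rho # w"
    "Theta # Rho # \<zeta> n @ w = \<zeta> n @ Rho # Theta # w" for w
    using arg_cong[OF xi(1), of "\<lambda>z. z @ w"] arg_cong[OF xi(2), of "\<lambda>z. z @ w"]
      arg_cong[OF step, of "\<lambda>z. z @ w"]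
    by simp_all
  show ?thesis
    using assms(2)
    by cases (auto simp: hom_def rotM_def Y_mor_def t_mor_def rotU_def rotU_inv_def u_mor_def
        v_mor_def u_mor'_def v_mor'_def M_mor_def ev coev rt tr rev_zeta xi step shift)
qed

lemma mor_eq_hom:
  assumes "n \<ge> 1" and "mor_eq n \<omega> \<sigma> f g"
  shows "\<exists>a b. f \<in> hom n a b \<and> g \<in> hom n a b"
  using assms(2)
proof induction
  case (of_skein f g)
  then show ?case using skein_hom assms(1) by blast
next
  case (adj_cong f g)
  then show ?case using adj_hom by blast
next
  case (pivotal f a b)
  then show ?case
    using ev_hom[of "rev b" n] ev_hom[of b n] coev_hom[of a n] coev_hom[of "rev a" n]
    by (auto simp: hom_def left_dual_def right_dual_def)
qed (auto simp: hom_def)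

end

theory Submission imports Defs begin

text \<open>
  The evaluation is a jellyfish algorithm.  Call a diagram without \<open>GenU\<close> and \<open>GenUStar\<close>
  \<open>U\<close>-free.  Bending all legs of a generator to the top turns \<open>GenUStar\<close> and \<open>GenU\<close> into the
  adjoints of \<open>u\<close> and \<open>v\<close>, morphisms from the empty word to an alternating word in the two colours
  (\<open>bentU\<close>).  The argument follows a morphism \<open>1 \<rightarrow> w\<close> while a diagram is stacked on it piece by piece,
  and shows that it always stays in one explicitly described span (\<open>jelly\<close>), which contains only
  scalars when \<open>w\<close> is empty.

  The first ingredient is a normal form for \<open>U\<close>-free diagrams.  Their category is the free product of
  the Fibonacci category and of \<open>Z/2\<close>, in which the reduced words are the words with no two equal adjacent
  letters, and there are no nonzero morphisms between different reduced words.  Here this takes the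
  following form: morphisms obtained from morphisms into reduced words by only splitting
  strands (cups and upside-down vertices) span a space that is stable under fusing strands (caps and vertices),
  because a fusing layer that meets a splitting layer simplifies locally, and a fusing layer never
  fits on a reduced word (\<open>split_span_fuse\<close>).

  The second ingredient describes the morphisms into reduced words (\<open>chain\<close>).  Place bent generators
  next to each other.  Two neighbours of the same kind meet in different colours.  Two neighbours
  of different kinds meet in equal colours, and the meeting strands are fused pair by pair: either
  some pair of \<open>\<rho>\<close>-strands fuses to one \<open>\<rho>\<close>-strand, and then the word is reduced there, or half of the legs
  of each of the two are joined, and then unitarity cancels both generators (\<open>bentU_ev_bentU\<close>).  Since at
  most half of the legs of a generator are used on either side, a nonempty chain never ends in the
  empty word.

  The third ingredient moves a bent generator, inserted anywhere, to the right end of the word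
  (\<open>jelly_insert\<close>).  The adjoints of the jellyfish relations move it through one strand at the cost of
  \<open>U\<close>-free diagrams and possibly one more bent generator, which also lies to the right of that strand.
  A \<open>v\<close>-type generator next to a \<open>\<rho>\<close>-strand is first rotated into a \<open>u\<close>-type generator.
\<close>

section \<open>Classes of morphisms and layers acting on them\<close>

locale skein_category =
  fixes n :: nat and \<omega> \<sigma> :: complex
  assumes n_pos: "n \<ge> 1"
begin

abbreviation equiv_mor :: "mor \<Rightarrow> mor \<Rightarrow> bool" (infix \<open>\<approx>\<close> 50) where
  "f \<approx> g \<equiv> mor_eq n \<omega> \<sigma> f g"

declare mor_trans [trans]

lemma hom_Id: "Id a \<in> hom n a a"
  and hom_comp: "f \<in> hom n b c \<Longrightarrow> g \<in> hom n a b \<Longrightarrow> f \<odot> g \<in> hom n a c"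
  and hom_tens: "f \<in> hom n a b \<Longrightarrow> g \<in> hom n a' b' \<Longrightarrow> f \<otimes> g \<in> hom n (a @ a') (b @ b')"
  by (auto simp: hom_def)

lemma hom_compD: "f \<odot> g \<in> hom n a c \<Longrightarrow> \<exists>b. f \<in> hom n b c \<and> g \<in> hom n a b"
  by (auto simp: hom_def)

lemma hom_unique: "f \<in> hom n a b \<Longrightarrow> f \<in> hom n a' b' \<Longrightarrow> a' = a \<and> b' = b"
  by (auto simp: hom_def)

lemma equiv_hom: "f \<approx> g \<Longrightarrow> f \<in> hom n a b \<longleftrightarrow> g \<in> hom n a b"
  using mor_eq_hom[OF n_pos, of \<omega> \<sigma> f g] hom_unique by metis

lemma equiv_typed: "f \<approx> g \<Longrightarrow> \<exists>a b. f \<in> hom n a b \<and> g \<in> hom n a b"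
  using mor_eq_hom[OF n_pos] .

text \<open>
  The class of an ill-typed expression is empty, because \<open>\<approx>\<close> relates only well-typed expressions.
  For this reason most of the equations between actions below need no typing hypothesis on the state.
\<close>
definition cls :: "mor \<Rightarrow> mor set" where
  "cls f = {g. f \<approx> g}"

definition states :: "obj \<Rightarrow> mor set set" where
  "states w = cls ` hom n [] w"

definition app :: "mor \<Rightarrow> mor set \<Rightarrow> mor set" where
  "app F X = {h. \<exists>f\<in>X. F \<odot> f \<approx> h}"

text \<open>
  A state of \<open>w\<close> is a class of morphisms \<open>1 \<rightarrow> w\<close>.  In \<open>act c g e X\<close> the diagram \<open>g\<close> is stacked on the
  state \<open>X\<close>, with the strands \<open>c\<close> to its left and the strands \<open>e\<close> to its right.  Working with actions
  turns the tensor product and its associativity into concatenation of words, so that equations of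
  string diagrams become equations that can be used for rewriting.
\<close>
definition act :: "obj \<Rightarrow> mor \<Rightarrow> obj \<Rightarrow> mor set \<Rightarrow> mor set" where
  "act c g e = app (Id c \<otimes> g \<otimes> Id e)"

lemma cls_eqI: "f \<approx> g \<Longrightarrow> cls f = cls g"
  unfolding cls_def by (auto intro: mor_trans mor_sym)

lemma cls_eqD: "cls f = cls g \<Longrightarrow> g \<in> hom n a b \<Longrightarrow> f \<approx> g"
  unfolding cls_def by (auto intro: mor_refl)

lemma app_cong: assumes "F \<approx> F'" shows "app F X = app F' X"
proof -
  have *: "F' \<odot> f \<approx> h" if h: "F \<odot> f \<approx> h" and F: "F \<approx> F'" for F F' f h
  proof -
    obtain a b where "F \<odot> f \<in> hom n a b" using equiv_typed[OF h] by blast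
    then obtain b' where t: "F \<in> hom n b' b" "f \<in> hom n a b'" using hom_compD by blast
    have "F \<odot> f \<approx> F' \<odot> f" using comp_cong[OF F mor_refl[OF t(2)] t] .
    from mor_trans[OF mor_sym[OF this] h] show ?thesis .
  qed
  show ?thesis using *[OF _ assms] *[OF _ mor_sym[OF assms]] unfolding app_def by blast
qed

lemma app_comp: "app (F \<odot> G) X = app F (app G X)"
proof -
  have "(F \<odot> G) \<odot> f \<approx> h \<longleftrightarrow> (\<exists>k. G \<odot> f \<approx> k \<and> F \<odot> k \<approx> h)" for f h
  proof
    assume *: "(F \<odot> G) \<odot> f \<approx> h"
    then obtain a d where "(F \<odot> G) \<odot> f \<in> hom n a d" using equiv_typed by blast
    then obtain b c where t: "F \<in> hom n c d" "G \<in> hom n b c" "f \<in> hom n a b"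
      by (auto simp: hom_def)
    have "F \<odot> G \<odot> f \<approx> h" using mor_trans[OF mor_sym[OF comp_assoc[OF t]] *] .
    moreover have "G \<odot> f \<approx> G \<odot> f" using mor_refl[OF hom_comp[OF t(2,3)]] .
    ultimately show "\<exists>k. G \<odot> f \<approx> k \<and> F \<odot> k \<approx> h" by blast
  next
    assume "\<exists>k. G \<odot> f \<approx> k \<and> F \<odot> k \<approx> h"
    then obtain k where k: "G \<odot> f \<approx> k" "F \<odot> k \<approx> h" by blast
    obtain a d where "F \<odot> k \<in> hom n a d" using equiv_typed[OF k(2)] by blast
    then obtain c where F: "F \<in> hom n c d" "k \<in> hom n a c" using hom_compD by blast
    then have "G \<odot> f \<in> hom n a c" using k equiv_hom by blast
    then obtain b where G: "G \<in> hom n b c" "f \<in> hom n a b" using hom_compD by blast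
    have "F \<odot> G \<odot> f \<approx> F \<odot> k"
      using comp_cong[OF mor_refl[OF F(1)] k(1) F(1) \<open>G \<odot> f \<in> hom n a c\<close>] .
    then show "(F \<odot> G) \<odot> f \<approx> h"
      using mor_trans[OF comp_assoc[OF F(1) G]] mor_trans[OF _ k(2)] by blast
  qed
  then show ?thesis unfolding app_def by blast
qed

lemma app_cls: "f \<in> hom n a b \<Longrightarrow> F \<in> hom n b c \<Longrightarrow> app F (cls f) = cls (F \<odot> f)"
proof -
  assume t: "f \<in> hom n a b" "F \<in> hom n b c"
  have "F \<odot> f' \<approx> F \<odot> f" if "f \<approx> f'" for f'
    using comp_cong[OF mor_refl[OF t(2)] that t(2) t(1)] mor_sym by blast
  moreover have "f \<approx> f" using t mor_refl by blast
  ultimately show ?thesis unfolding app_def cls_def by (blast intro: mor_trans mor_sym)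
qed

lemma app_id: "X \<in> states w \<Longrightarrow> app (Id w) X = X"
  unfolding states_def using app_cls[OF _ hom_Id] cls_eqI[OF id_comp] by auto

lemma layer_hom: "g \<in> hom n a b \<Longrightarrow> Id c \<otimes> g \<otimes> Id e \<in> hom n (c @ a @ e) (c @ b @ e)"
  by (auto simp: hom_def)

lemma act_states:
  "g \<in> hom n a b \<Longrightarrow> X \<in> states (c @ a @ e) \<Longrightarrow> act c g e X \<in> states (c @ b @ e)"
  unfolding states_def act_def using app_cls[OF _ layer_hom] hom_comp[OF layer_hom] by auto

lemma act_cong: assumes "g \<approx> g'" shows "act c g e X = act c g' e X"
proof -
  have "Id c \<otimes> g \<otimes> Id e \<approx> Id c \<otimes> g' \<otimes> Id e"
    by (intro tens_cong assms mor_refl[OF hom_Id])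
  then show ?thesis unfolding act_def by (rule app_cong)
qed

lemma id_idem: "Id a \<approx> Id a \<odot> Id a"
  using id_comp[OF hom_Id] mor_sym by blast

lemma act_comp:
  assumes "g \<in> hom n b d" "h \<in> hom n a b"
  shows "act c (g \<odot> h) e X = act c g e (act c h e X)"
proof -
  have 1: "(g \<odot> h) \<otimes> Id e \<approx> (g \<otimes> Id e) \<odot> (h \<otimes> Id e)"
    using mor_trans[OF tens_cong[OF mor_refl[OF hom_comp[OF assms]] id_idem]
        interchange[OF assms hom_Id hom_Id]] .
  have "Id c \<otimes> (g \<odot> h) \<otimes> Id e \<approx> (Id c \<otimes> g \<otimes> Id e) \<odot> (Id c \<otimes> h \<otimes> Id e)"
    using mor_trans[OF tens_cong[OF id_idem 1]
        interchange[OF hom_Id hom_Id hom_tens[OF assms(1) hom_Id] hom_tens[OF assms(2) hom_Id]]] .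
  then show ?thesis unfolding act_def app_comp[symmetric] by (rule app_cong)
qed

lemma act_id: "X \<in> states (c @ a @ e) \<Longrightarrow> act c (Id a) e X = X"
proof -
  assume X: "X \<in> states (c @ a @ e)"
  have "Id c \<otimes> Id a \<otimes> Id e \<approx> Id (c @ a @ e)"
    using mor_trans[OF tens_cong[OF mor_refl[OF hom_Id] tens_id] tens_id] .
  then show ?thesis unfolding act_def using app_cong app_id[OF X] by metis
qed

lemma act_tens_id:
  assumes "g \<in> hom n a b"
  shows "act c (g \<otimes> Id d) e X = act c g (d @ e) X"
proof -
  have "(g \<otimes> Id d) \<otimes> Id e \<approx> g \<otimes> Id (d @ e)"
    using mor_trans[OF tens_assoc[OF assms hom_Id hom_Id] tens_cong[OF mor_refl[OF assms] tens_id]] .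
  then have "Id c \<otimes> (g \<otimes> Id d) \<otimes> Id e \<approx> Id c \<otimes> g \<otimes> Id (d @ e)"
    by (rule tens_cong[OF mor_refl[OF hom_Id]])
  then show ?thesis unfolding act_def by (rule app_cong)
qed

lemma act_id_tens:
  assumes "g \<in> hom n a b"
  shows "act c (Id d \<otimes> g) e X = act (c @ d) g e X"
proof -
  have "Id c \<otimes> (Id d \<otimes> g) \<otimes> Id e \<approx> Id c \<otimes> Id d \<otimes> g \<otimes> Id e"
    by (rule tens_cong[OF mor_refl[OF hom_Id] tens_assoc[OF hom_Id assms hom_Id]])
  also have "Id c \<otimes> Id d \<otimes> g \<otimes> Id e \<approx> (Id c \<otimes> Id d) \<otimes> g \<otimes> Id e"
    by (rule mor_sym[OF tens_assoc[OF hom_Id hom_Id hom_tens[OF assms hom_Id]]])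
  also have "(Id c \<otimes> Id d) \<otimes> g \<otimes> Id e \<approx> Id (c @ d) \<otimes> g \<otimes> Id e"
    by (rule tens_cong[OF tens_id mor_refl[OF hom_tens[OF assms hom_Id]]])
  finally show ?thesis unfolding act_def by (rule app_cong)
qed

lemma act_tens:
  assumes "g \<in> hom n a b" "h \<in> hom n a' b'"
  shows "act c (g \<otimes> h) e X = act c g (b' @ e) (act (c @ a) h e X)"
    and "act c (g \<otimes> h) e X = act (c @ b) h e (act c g (a' @ e) X)"
proof -
  have "g \<otimes> h \<approx> (g \<odot> Id a) \<otimes> (Id b' \<odot> h)"
    using tens_cong[OF mor_sym[OF comp_id] mor_sym[OF id_comp]] assms by blast
  then have *: "g \<otimes> h \<approx> (g \<otimes> Id b') \<odot> (Id a \<otimes> h)"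
    using interchange[OF assms(1) hom_Id hom_Id assms(2)] mor_trans by blast
  show "act c (g \<otimes> h) e X = act c g (b' @ e) (act (c @ a) h e X)"
    by (simp add: act_cong[OF *] act_comp[OF hom_tens[OF assms(1) hom_Id] hom_tens[OF hom_Id assms(2)]]
      act_tens_id[OF assms(1)] act_id_tens[OF assms(2)])
  have "g \<otimes> h \<approx> (Id b \<odot> g) \<otimes> (h \<odot> Id a')"
    using tens_cong[OF mor_sym[OF id_comp] mor_sym[OF comp_id]] assms by blast
  then have *: "g \<otimes> h \<approx> (Id b \<otimes> h) \<odot> (g \<otimes> Id a')"
    using interchange[OF hom_Id assms(1) assms(2) hom_Id] mor_trans by blast
  show "act c (g \<otimes> h) e X = act (c @ b) h e (act c g (a' @ e) X)"
    by (simp add: act_cong[OF *] act_comp[OF hom_tens[OF hom_Id assms(2)] hom_tens[OF assms(1) hom_Id]]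
      act_tens_id[OF assms(1)] act_id_tens[OF assms(2)])
qed

text \<open>
  Diagrams over disjoint strands can be slid past each other; \<open>d\<close> is the word of strands between them.
\<close>
lemma act_exchange:
  assumes "g \<in> hom n a b" "h \<in> hom n a' b'"
  shows "act c g (d @ b' @ e) (act (c @ a @ d) h e X) = act (c @ b @ d) h e (act c g (d @ a' @ e) X)"
  using act_tens[OF assms(1) hom_tens[OF hom_Id[of d] assms(2)], of c e X]
  by (simp add: act_id_tens[OF assms(2)])

text \<open>The linear structure of the hom-spaces, transported to classes.\<close>

definition add :: "mor set \<Rightarrow> mor set \<Rightarrow> mor set" where
  "add X Y = {h. \<exists>f\<in>X. \<exists>g\<in>Y. f \<oplus> g \<approx> h}"

definition scl :: "complex \<Rightarrow> mor set \<Rightarrow> mor set" where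
  "scl k X = {h. \<exists>f\<in>X. k \<bullet> f \<approx> h}"

definition zer :: "obj \<Rightarrow> mor set" where
  "zer w = cls (Zero [] w)"

definition vac :: "mor set" where
  "vac = cls (Id [])"

lemma add_cls: "f \<in> hom n a b \<Longrightarrow> g \<in> hom n a b \<Longrightarrow> add (cls f) (cls g) = cls (f \<oplus> g)"
proof -
  assume t: "f \<in> hom n a b" "g \<in> hom n a b"
  have "f \<oplus> g \<approx> f' \<oplus> g'" if "f \<approx> f'" "g \<approx> g'" for f' g'
    using plus_cong[OF that t] .
  moreover have "f \<approx> f" "g \<approx> g" using t mor_refl by auto
  ultimately show ?thesis unfolding add_def cls_def by (blast intro: mor_trans mor_sym)
qed

lemma scl_cls: "f \<in> hom n a b \<Longrightarrow> scl k (cls f) = cls (k \<bullet> f)"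
proof -
  assume t: "f \<in> hom n a b"
  have "k \<bullet> f \<approx> k \<bullet> f'" if "f \<approx> f'" for f'
    using scale_cong[OF that] .
  moreover have "f \<approx> f" using t mor_refl by auto
  ultimately show ?thesis unfolding scl_def cls_def by (blast intro: mor_trans mor_sym)
qed

lemma hom_plus: "f \<in> hom n a b \<Longrightarrow> g \<in> hom n a b \<Longrightarrow> f \<oplus> g \<in> hom n a b"
  and hom_scale: "f \<in> hom n a b \<Longrightarrow> k \<bullet> f \<in> hom n a b"
  and hom_Zero: "Zero a b \<in> hom n a b"
  by (auto simp: hom_def)

lemma statesE: assumes "X \<in> states w" obtains f where "f \<in> hom n [] w" "X = cls f"
  using assms unfolding states_def by blast

lemma statesI: "f \<in> hom n [] w \<Longrightarrow> cls f \<in> states w"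
  unfolding states_def by blast

lemma add_states: "X \<in> states w \<Longrightarrow> Y \<in> states w \<Longrightarrow> add X Y \<in> states w"
  by (elim statesE) (simp add: add_cls statesI hom_plus)

lemma scl_states: "X \<in> states w \<Longrightarrow> scl k X \<in> states w"
  by (elim statesE) (simp add: scl_cls statesI hom_scale)

lemma zer_states: "zer w \<in> states w"
  unfolding states_def zer_def using hom_Zero by blast

lemma vac_states: "vac \<in> states []"
  unfolding states_def vac_def using hom_Id by blast

lemma act_add:
  assumes "g \<in> hom n a b" "X \<in> states (c @ a @ e)" "Y \<in> states (c @ a @ e)"
  shows "act c g e (add X Y) = add (act c g e X) (act c g e Y)"
proof -
  obtain f where f: "f \<in> hom n [] (c @ a @ e)" "X = cls f" using assms(2) by (rule statesE)
  obtain h where h: "h \<in> hom n [] (c @ a @ e)" "Y = cls h" using assms(3) by (rule statesE)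
  note L = layer_hom[OF assms(1), of c e]
  show ?thesis
    by (simp add: f(2) h(2) act_def app_cls[OF f(1) L] app_cls[OF h(1) L] add_cls[OF f(1) h(1)]
        app_cls[OF hom_plus[OF f(1) h(1)] L] add_cls[OF hom_comp[OF L f(1)] hom_comp[OF L h(1)]]
        cls_eqI[OF comp_plus_right[OF L f(1) h(1)]])
qed

lemma act_scl:
  assumes "g \<in> hom n a b" "X \<in> states (c @ a @ e)"
  shows "act c g e (scl k X) = scl k (act c g e X)"
proof -
  obtain f where f: "f \<in> hom n [] (c @ a @ e)" "X = cls f" using assms(2) by (rule statesE)
  note L = layer_hom[OF assms(1), of c e]
  show ?thesis
    by (simp add: f(2) act_def app_cls[OF f(1) L] scl_cls[OF f(1)] app_cls[OF hom_scale[OF f(1)] L]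
        scl_cls[OF hom_comp[OF L f(1)]] cls_eqI[OF comp_scale_right[OF L f(1)]])
qed

lemma zer_eq: "X \<in> states w \<Longrightarrow> scl 0 X = zer w"
  by (elim statesE) (simp add: zer_def scl_cls cls_eqI[OF scale_zero])

lemma act_zer: assumes "g \<in> hom n a b" shows "act c g e (zer (c @ a @ e)) = zer (c @ b @ e)"
  using act_scl[OF assms zer_states, of c e 0] zer_eq[OF zer_states] zer_eq[OF act_states[OF assms zer_states]]
  by simp

lemma act_Plus:
  assumes "g \<in> hom n a b" "h \<in> hom n a b" "X \<in> states (c @ a @ e)"
  shows "act c (g \<oplus> h) e X = add (act c g e X) (act c h e X)"
proof -
  obtain f where f: "f \<in> hom n [] (c @ a @ e)" "X = cls f" using assms statesE by metis
  have "Id c \<otimes> (g \<oplus> h) \<otimes> Id e \<approx> Id c \<otimes> (g \<otimes> Id e \<oplus> h \<otimes> Id e)"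
    by (rule tens_cong[OF mor_refl[OF hom_Id] tens_plus_left[OF assms(1,2) hom_Id]])
  also have "Id c \<otimes> (g \<otimes> Id e \<oplus> h \<otimes> Id e) \<approx> Id c \<otimes> g \<otimes> Id e \<oplus> Id c \<otimes> h \<otimes> Id e"
    by (rule tens_plus_right[OF hom_Id hom_tens[OF assms(1) hom_Id] hom_tens[OF assms(2) hom_Id]])
  finally have "act c (g \<oplus> h) e X = app (Id c \<otimes> g \<otimes> Id e \<oplus> Id c \<otimes> h \<otimes> Id e) X"
    unfolding act_def by (rule app_cong)
  with layer_hom[OF assms(1), of c e] layer_hom[OF assms(2), of c e] show ?thesis
    using cls_eqI[OF comp_plus_left[OF layer_hom[OF assms(1)] layer_hom[OF assms(2)] f(1)]]
      app_cls[OF f(1) hom_plus[OF layer_hom[OF assms(1)] layer_hom[OF assms(2)]]]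
      app_cls[OF f(1) layer_hom[OF assms(1)]] app_cls[OF f(1) layer_hom[OF assms(2)]]
      add_cls[OF hom_comp[OF layer_hom[OF assms(1)] f(1)] hom_comp[OF layer_hom[OF assms(2)] f(1)]]
    by (simp add: act_def f(2))
qed

lemma act_Scale:
  assumes "g \<in> hom n a b" "X \<in> states (c @ a @ e)"
  shows "act c (k \<bullet> g) e X = scl k (act c g e X)"
proof -
  obtain f where f: "f \<in> hom n [] (c @ a @ e)" "X = cls f" using assms statesE by metis
  have "Id c \<otimes> (k \<bullet> g) \<otimes> Id e \<approx> Id c \<otimes> (k \<bullet> (g \<otimes> Id e))"
    by (rule tens_cong[OF mor_refl[OF hom_Id] tens_scale_left[OF assms(1) hom_Id]])
  also have "Id c \<otimes> (k \<bullet> (g \<otimes> Id e)) \<approx> k \<bullet> (Id c \<otimes> g \<otimes> Id e)"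
    by (rule tens_scale_right[OF hom_Id hom_tens[OF assms(1) hom_Id]])
  finally have "act c (k \<bullet> g) e X = app (k \<bullet> (Id c \<otimes> g \<otimes> Id e)) X"
    unfolding act_def by (rule app_cong)
  then show ?thesis
    using cls_eqI[OF comp_scale_left[OF layer_hom[OF assms(1)] f(1)]]
      app_cls[OF f(1) hom_scale[OF layer_hom[OF assms(1)]]] app_cls[OF f(1) layer_hom[OF assms(1)]]
      scl_cls[OF hom_comp[OF layer_hom[OF assms(1)] f(1)]]
    by (simp add: act_def f(2))
qed

lemma act_Zero:
  assumes "X \<in> states (c @ a @ e)"
  shows "act c (Zero a b) e X = zer (c @ b @ e)"
proof -
  have "Zero a b \<approx> 0 \<bullet> Zero a b" using scale_zero[OF hom_Zero] mor_sym by blast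
  then show ?thesis
    using act_cong act_Scale[OF hom_Zero assms] zer_eq[OF act_states[OF hom_Zero assms]] by metis
qed

lemma scl_one: "X \<in> states w \<Longrightarrow> scl 1 X = X"
  by (elim statesE) (simp add: scl_cls cls_eqI[OF scale_one])

lemma scl_scl: "X \<in> states w \<Longrightarrow> scl k (scl l X) = scl (k * l) X"
  by (elim statesE) (simp add: scl_cls scl_cls[OF hom_scale] cls_eqI[OF scale_scale])

lemma add_scl: "X \<in> states w \<Longrightarrow> add (scl k X) (scl l X) = scl (k + l) X"
  by (elim statesE) (simp add: scl_cls add_cls[OF hom_scale hom_scale] cls_eqI[OF scale_add])

lemma add_assoc:
  "X \<in> states w \<Longrightarrow> Y \<in> states w \<Longrightarrow> Z \<in> states w \<Longrightarrow> add (add X Y) Z = add X (add Y Z)"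
  by (elim statesE)
    (simp add: add_cls add_cls[OF hom_plus] add_cls[OF _ hom_plus] cls_eqI[OF plus_assoc])

lemma zer_add: "X \<in> states w \<Longrightarrow> add (zer w) X = X"
  by (elim statesE) (simp add: zer_def add_cls[OF hom_Zero] cls_eqI[OF zero_plus])

section \<open>Local relations for strands and vertices\<close>

lemma hom_Cap: "Cap x \<in> hom n [x, x] []"
  and hom_Cup: "Cup x \<in> hom n [] [x, x]"
  and hom_GenM: "GenM \<in> hom n [Rho, Rho] [Rho]"
  and hom_GenMStar: "GenMStar \<in> hom n [Rho] [Rho, Rho]"
  by (simp_all add: hom_def)

lemma zigzag_left_act:
  assumes "X \<in> states (c @ x # e)"
  shows "act c (Cap x) (x # e) (act (c @ [x]) (Cup x) e X) = X"
proof -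
  have "act c (Cap x) (x # e) (act (c @ [x]) (Cup x) e X)
      = act c ((Cap x \<otimes> Id [x]) \<odot> (Id [x] \<otimes> Cup x)) e X"
    by (simp add: act_comp[of _ "[x, x, x]" "[x]" _ "[x]"] hom_def act_tens_id[OF hom_Cap]
        act_id_tens[OF hom_Cup])
  also have "\<dots> = X" using act_cong[OF zigzag_left] act_id[of X c "[x]" e] assms by simp
  finally show ?thesis .
qed

lemma zigzag_right_act:
  assumes "X \<in> states (c @ x # e)"
  shows "act (c @ [x]) (Cap x) e (act c (Cup x) (x # e) X) = X"
proof -
  have "act (c @ [x]) (Cap x) e (act c (Cup x) (x # e) X)
      = act c ((Id [x] \<otimes> Cap x) \<odot> (Cup x \<otimes> Id [x])) e X"
    by (simp add: act_comp[of _ "[x, x, x]" "[x]" _ "[x]"] hom_def act_id_tens[OF hom_Cap]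
        act_tens_id[OF hom_Cup])
  also have "\<dots> = X" using act_cong[OF zigzag_right] act_id[of X c "[x]" e] assms by simp
  finally show ?thesis .
qed

lemma mstar_eq_cup_m: "act c GenMStar e X = act (c @ [Rho]) GenM e (act c (Cup Rho) (Rho # e) X)"
  unfolding act_cong[OF of_skein[OF vertex_adjoint]] Y_mor_def
  by (simp add: act_comp[of _ "[Rho, Rho, Rho]" "[Rho, Rho]" _ "[Rho]"] hom_def
      act_id_tens[OF hom_GenM] act_tens_id[OF hom_Cup])

text \<open>
  Together with \<open>mstar_eq_cup_m\<close> this is the rotation invariance of the vertex.
\<close>
lemma cap_mstar_left: "act (c @ [Rho]) (Cap Rho) e (act c GenMStar (Rho # e) X) = act c GenM e X"
proof -
  have "act c GenM e X = act c rotM e X" by (rule act_cong[OF mor_sym[OF of_skein[OF vertex_rotation]]])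
  also have "\<dots> = act (c @ [Rho]) (Cap Rho) e (act c (Id [Rho] \<otimes> GenM \<otimes> Id [Rho]) e
      (act c (Cup Rho) (Rho # Rho # e) X))"
    unfolding rotM_def
    by (simp add: act_comp[of _ "[Rho, Rho, Rho]" "[Rho]" _ "[Rho, Rho]"]
        act_comp[of _ "[Rho, Rho, Rho, Rho]" "[Rho, Rho, Rho]" _ "[Rho, Rho]"] hom_def
        act_id_tens[OF hom_Cap] act_tens_id[OF hom_Cup])
  also have "\<dots> = act (c @ [Rho]) (Cap Rho) e (act c GenMStar (Rho # e) X)"
    by (simp add: act_id_tens[OF hom_tens[OF hom_GenM hom_Id]] act_tens_id[OF hom_GenM] mstar_eq_cup_m)
  finally show ?thesis by simp
qed

lemma m_cup_right:
  assumes "X \<in> states (c @ Rho # e)"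
  shows "act c GenM (Rho # e) (act (c @ [Rho]) (Cup Rho) e X) = act c GenMStar e X"
proof -
  have "act c GenM (Rho # e) (act (c @ [Rho]) (Cup Rho) e X)
      = act (c @ [Rho]) (Cap Rho) (Rho # e) (act c GenMStar (Rho # Rho # e) (act (c @ [Rho]) (Cup Rho) e X))"
    by (simp add: cap_mstar_left)
  also have "\<dots> = act (c @ [Rho]) (Cap Rho) (Rho # e) (act (c @ [Rho, Rho]) (Cup Rho) e (act c GenMStar e X))"
    using act_exchange[where c = c and d = "[]" and e = e and X = X, OF hom_GenMStar hom_Cup] by simp
  also have "\<dots> = act c GenMStar e X"
    using zigzag_left_act[of _ "c @ [Rho]" Rho e] act_states[OF hom_GenMStar, of X c e] assms by simp
  finally show ?thesis .
qed

lemma cap_mstar_right: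
  assumes "X \<in> states (c @ Rho # Rho # e)"
  shows "act c (Cap Rho) (Rho # e) (act (c @ [Rho]) GenMStar e X) = act c GenM e X"
  using act_exchange[where c = c and d = "[]" and e = e and X = "act (c @ [Rho]) (Cup Rho) (Rho # e) X", OF hom_Cap hom_GenM]
    zigzag_left_act[of X c Rho "Rho # e"] assms
  by (simp add: mstar_eq_cup_m)

lemma cap_mstar_zero:
  assumes "X \<in> states (c @ Rho # e)"
  shows "act c (Cap Rho) e (act c GenMStar e X) = zer (c @ e)"
  using act_cong[OF adj_cong[OF of_skein[OF tadpole]], of c e X] act_Zero[of X c "[Rho]" e "[]"] assms
  by (simp add: act_comp[OF hom_Cap hom_GenMStar])

lemma m_cup_zero:
  assumes "X \<in> states (c @ e)"
  shows "act c GenM e (act c (Cup Rho) e X) = zer (c @ Rho # e)"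
  using act_cong[OF of_skein[OF tadpole], of c e X] act_Zero[of X c "[]" e "[Rho]"] assms
  by (simp add: act_comp[OF hom_GenM hom_Cup])

lemma m_mstar:
  assumes "X \<in> states (c @ Rho # e)"
  shows "act c GenM e (act c GenMStar e X) = X"
  using act_cong[OF of_skein[OF bigon], of c e X] act_id[of X c "[Rho]" e] assms
  by (simp add: act_comp[OF hom_GenM hom_GenMStar])

lemma cap_cup_scalar:
  assumes "X \<in> states (c @ e)"
  shows "\<exists>k. act c (Cap x) e (act c (Cup x) e X) = scl k X"
proof (cases x)
  case Theta
  then have "act c (Cap x) e (act c (Cup x) e X) = scl 1 X"
    using act_cong[OF of_skein[OF theta_loop], of c e X] act_id[of X c "[]" e] assms
    by (simp add: act_comp[OF hom_Cap hom_Cup] scl_one)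
  then show ?thesis by blast
next
  case Rho
  then have "act c (Cap x) e (act c (Cup x) e X) = scl \<tau> X"
    using act_cong[OF of_skein[OF rho_loop], of c e X] act_id[of X c "[]" e] assms
    by (simp add: act_comp[OF hom_Cap hom_Cup] act_Scale[OF hom_Id])
  then show ?thesis by blast
qed

lemma theta_cut_act:
  assumes "X \<in> states (c @ Theta # Theta # e)"
  shows "X = act c (Cup Theta) e (act c (Cap Theta) e X)"
  using act_cong[OF of_skein[OF theta_cut], of c e X] act_id[of X c "[Theta, Theta]" e] assms
  by (simp add: act_comp[OF hom_Cup hom_Cap])

lemma rho_fusion_act:
  assumes "X \<in> states (c @ Rho # Rho # e)"
  shows "X = add (scl (1 / \<tau>) (act c (Cup Rho) e (act c (Cap Rho) e X)))
                 (act c GenMStar e (act c GenM e X))"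
  using act_cong[OF of_skein[OF rho_fusion], of c e X] act_id[of X c "[Rho, Rho]" e] assms
    act_Plus[OF hom_scale[OF hom_comp[OF hom_Cup hom_Cap]] hom_comp[OF hom_GenMStar hom_GenM], of X c e]
    act_Scale[OF hom_comp[OF hom_Cup hom_Cap], of X c Rho e]
  by (simp add: act_comp[OF hom_Cup hom_Cap] act_comp[OF hom_GenMStar hom_GenM])

lemma solve_second_summand:
  assumes "Z = add (scl k X) Y" "X \<in> states w" "Y \<in> states w"
  shows "Y = add (scl (- k) X) Z"
proof -
  have "add (scl (- k) X) Z = add (add (scl (- k) X) (scl k X)) Y"
    using assms by (simp add: add_assoc[OF scl_states scl_states])
  also have "\<dots> = Y" using assms by (simp add: add_scl zer_eq zer_add)
  finally show ?thesis by simp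
qed

text \<open>
  Turning the fusion relation for two vertical \<open>\<rho>\<close>-strands by a quarter turn exchanges the identity with
  \<open>Cup Rho \<odot> Cap Rho\<close> and turns \<open>GenMStar \<odot> GenM\<close> into the composite in question.
\<close>
lemma m_mstar_right:
  assumes X: "X \<in> states (c @ Rho # Rho # e)"
  shows "act c GenM (Rho # e) (act (c @ [Rho]) GenMStar e X)
    = add (scl (- (1 / \<tau>)) X) (act c (Cup Rho) e (act c (Cap Rho) e X))"
proof (rule solve_second_summand[OF _ X])
  \<comment> \<open>The turned relation arises by fusing the middle two of the strands of \<open>Z\<close> and capping off the
    leftmost pair.\<close>
  define Z where "Z = act (c @ [Rho, Rho]) (Cup Rho) e X"
  have Z: "Z \<in> states (c @ Rho # Rho # Rho # Rho # e)"
    using act_states[OF hom_Cup, of X "c @ [Rho, Rho]" e] X by (simp add: Z_def)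
  have 1: "act (c @ [Rho]) (Cap Rho) (Rho # e) Z = X"
    using zigzag_left_act[of X "c @ [Rho]" Rho e] X by (simp add: Z_def)
  have 2: "act (c @ [Rho]) GenM (Rho # e) Z = act (c @ [Rho]) GenMStar e X"
    using m_cup_right[of X "c @ [Rho]" e] X by (simp add: Z_def)
  have S: "act (c @ [Rho]) GenMStar e X \<in> states (c @ Rho # Rho # Rho # e)"
    using act_states[OF hom_GenMStar, of X "c @ [Rho]" e] X by simp
  then show "act c GenM (Rho # e) (act (c @ [Rho]) GenMStar e X) \<in> states (c @ Rho # Rho # e)"
    using act_states[OF hom_GenM, of _ c "Rho # e"] by simp
  have T: "act (c @ [Rho]) (Cup Rho) (Rho # e) X \<in> states (c @ Rho # Rho # Rho # Rho # e)"
    using act_states[OF hom_Cup, of X "c @ [Rho]" "Rho # e"] X by simp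
  have U: "act (c @ [Rho]) GenMStar (Rho # e) (act (c @ [Rho]) GenMStar e X)
      \<in> states (c @ Rho # Rho # Rho # Rho # e)"
    using act_states[OF hom_GenMStar, of _ "c @ [Rho]" "Rho # e"] S by simp
  have "Z = add (scl (1 / \<tau>) (act (c @ [Rho]) (Cup Rho) (Rho # e) X))
      (act (c @ [Rho]) GenMStar (Rho # e) (act (c @ [Rho]) GenMStar e X))"
    using rho_fusion_act[of Z "c @ [Rho]" "Rho # e"] Z by (simp add: 1 2)
  then have "act c (Cap Rho) (Rho # Rho # e) Z
      = add (scl (1 / \<tau>) X) (act c GenM (Rho # e) (act (c @ [Rho]) GenMStar e X))"
    using act_add[OF hom_Cap, of "scl (1 / \<tau>) (act (c @ [Rho]) (Cup Rho) (Rho # e) X)" c Rho "Rho # Rho # e"]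
      act_scl[OF hom_Cap, of "act (c @ [Rho]) (Cup Rho) (Rho # e) X" c Rho "Rho # Rho # e"]
      zigzag_left_act[of X c Rho "Rho # e"] cap_mstar_right[of _ c "Rho # e"] X S T U
    by (simp add: scl_states)
  then show "act c (Cup Rho) e (act c (Cap Rho) e X)
      = add (scl (1 / \<tau>) X) (act c GenM (Rho # e) (act (c @ [Rho]) GenMStar e X))"
    using act_exchange[where c = c and d = "[]" and e = e and X = X, OF hom_Cap hom_Cup] by (simp add: Z_def)
qed

lemma m_mstar_left:
  assumes X: "X \<in> states (c @ Rho # Rho # e)"
  shows "act (c @ [Rho]) GenM e (act c GenMStar (Rho # e) X)
    = add (scl (- (1 / \<tau>)) X) (act c (Cup Rho) e (act c (Cap Rho) e X))"
proof (rule solve_second_summand[OF _ X])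
  define Z where "Z = act c (Cup Rho) (Rho # Rho # e) X"
  have Z: "Z \<in> states (c @ Rho # Rho # Rho # Rho # e)"
    using act_states[OF hom_Cup, of X c "Rho # Rho # e"] X by (simp add: Z_def)
  have 1: "act (c @ [Rho]) (Cap Rho) (Rho # e) Z = X"
    using zigzag_right_act[of X c Rho "Rho # e"] X by (simp add: Z_def)
  have 2: "act (c @ [Rho]) GenM (Rho # e) Z = act c GenMStar (Rho # e) X"
    by (simp add: Z_def mstar_eq_cup_m)
  have S: "act c GenMStar (Rho # e) X \<in> states (c @ Rho # Rho # Rho # e)"
    using act_states[OF hom_GenMStar, of X c "Rho # e"] X by simp
  then show "act (c @ [Rho]) GenM e (act c GenMStar (Rho # e) X) \<in> states (c @ Rho # Rho # e)"
    using act_states[OF hom_GenM, of _ "c @ [Rho]" e] by simp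
  have T: "act (c @ [Rho]) (Cup Rho) (Rho # e) X \<in> states (c @ Rho # Rho # Rho # Rho # e)"
    using act_states[OF hom_Cup, of X "c @ [Rho]" "Rho # e"] X by simp
  have U: "act (c @ [Rho]) GenMStar (Rho # e) (act c GenMStar (Rho # e) X)
      \<in> states (c @ Rho # Rho # Rho # Rho # e)"
    using act_states[OF hom_GenMStar, of _ "c @ [Rho]" "Rho # e"] S by simp
  have "Z = add (scl (1 / \<tau>) (act (c @ [Rho]) (Cup Rho) (Rho # e) X))
      (act (c @ [Rho]) GenMStar (Rho # e) (act c GenMStar (Rho # e) X))"
    using rho_fusion_act[of Z "c @ [Rho]" "Rho # e"] Z by (simp add: 1 2)
  then have "act (c @ [Rho, Rho]) (Cap Rho) e Z
      = add (scl (1 / \<tau>) X) (act (c @ [Rho]) GenM e (act c GenMStar (Rho # e) X))"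
    using act_add[OF hom_Cap, of "scl (1 / \<tau>) (act (c @ [Rho]) (Cup Rho) (Rho # e) X)" "c @ [Rho, Rho]" Rho e]
      act_scl[OF hom_Cap, of "act (c @ [Rho]) (Cup Rho) (Rho # e) X" "c @ [Rho, Rho]" Rho e]
      zigzag_right_act[of X "c @ [Rho]" Rho e] cap_mstar_left[of "c @ [Rho]" e] X S T U
    by (simp add: scl_states)
  then show "act c (Cup Rho) e (act c (Cap Rho) e X)
      = add (scl (1 / \<tau>) X) (act (c @ [Rho]) GenM e (act c GenMStar (Rho # e) X))"
    using act_exchange[where c = c and d = "[]" and e = e and X = X, OF hom_Cup hom_Cap] by (simp add: Z_def)
qed

section \<open>Normal form of diagrams without U\<close>

inductive fuses :: "mor \<Rightarrow> colour \<Rightarrow> obj \<Rightarrow> bool" where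
  "fuses (Cap x) x []"
| "fuses GenM Rho [Rho]"

inductive splits :: "mor \<Rightarrow> colour \<Rightarrow> obj \<Rightarrow> bool" where
  "splits (Cup x) x []"
| "splits GenMStar Rho [Rho]"

lemma fuses_hom: "fuses g x b \<Longrightarrow> g \<in> hom n [x, x] b"
  by (induction rule: fuses.induct) (simp_all add: hom_Cap hom_GenM)

lemma splits_hom: "splits h x a \<Longrightarrow> h \<in> hom n a [x, x]"
  by (induction rule: splits.induct) (simp_all add: hom_Cup hom_GenMStar)

inductive u_free :: "mor \<Rightarrow> bool" where
  Id: "u_free (Id w)"
| Cap: "u_free (Cap x)"
| Cup: "u_free (Cup x)"
| GenM: "u_free GenM"
| GenMStar: "u_free GenMStar"
| comp: "u_free S \<Longrightarrow> u_free T \<Longrightarrow> u_free (S \<odot> T)"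
| tens: "u_free S \<Longrightarrow> u_free T \<Longrightarrow> u_free (S \<otimes> T)"

lemma u_free_ev: "u_free (ev w)"
  and u_free_coev: "u_free (coev w)"
  by (induction w) (simp_all add: u_free.intros)

lemma act_ev_Cons: "act c (ev (y # b)) e X = act c (Cap y) e (act (c @ [y]) (ev b) (y # e) X)"
proof -
  have "Id [y] \<otimes> ev b \<otimes> Id [y] \<in> hom n (y # b @ rev b @ [y]) [y, y]"
    using hom_tens[OF hom_Id hom_tens[OF ev_hom[of b n] hom_Id], of "[y]" "[y]"] by simp
  then show ?thesis
    by (simp add: act_comp[OF hom_Cap] act_id_tens[OF hom_tens[OF ev_hom hom_Id]] act_tens_id[OF ev_hom])
qed

lemma act_coev_Cons: "act c (coev (y # b)) e X = act (c @ [y]) (coev b) (y # e) (act c (Cup y) e X)"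
proof -
  have "Id [y] \<otimes> coev b \<otimes> Id [y] \<in> hom n [y, y] (y # b @ rev b @ [y])"
    using hom_tens[OF hom_Id hom_tens[OF coev_hom[of b n] hom_Id], of "[y]" "[y]"] by simp
  then show ?thesis
    by (simp add: act_comp[OF _ hom_Cup] act_id_tens[OF hom_tens[OF coev_hom hom_Id]] act_tens_id[OF coev_hom])
qed

lemma act_ev_snoc:
  "act c (ev (b @ [x])) e X = act c (ev b) e (act (c @ b) (Cap x) (rev b @ e) X)"
proof (induction b arbitrary: c e X)
  case Nil
  have "ev [x] \<approx> Cap x"
  proof -
    have "Id [x] \<otimes> Id [] \<otimes> Id [x] \<approx> Id ([x] @ [] @ [x])"
      using mor_trans[OF tens_cong[OF mor_refl[OF hom_Id] tens_id] tens_id] by blast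
    then have "Cap x \<odot> (Id [x] \<otimes> Id [] \<otimes> Id [x]) \<approx> Cap x \<odot> Id [x, x]"
      by (intro comp_cong[OF mor_refl[OF hom_Cap] _ hom_Cap]) (simp_all add: hom_def)
    then show ?thesis using mor_trans comp_id[OF hom_Cap] by (auto intro: mor_trans)
  qed
  moreover have "act c (Id []) e (act c (Cap x) e X) = act c (Cap x) e X"
    using act_cong[OF id_comp[OF hom_Cap], of c x e X] by (simp add: act_comp[OF hom_Id hom_Cap])
  ultimately show ?case by (simp add: act_cong)
next
  case (Cons y b)
  show ?case
    using Cons[of "c @ [y]" "y # e" X] act_ev_Cons[of c y b] act_ev_Cons[of c y "b @ [x]"]
    by simp
qed

lemma act_coev_snoc:
  "act c (coev (b @ [x])) e X = act (c @ b) (Cup x) (rev b @ e) (act c (coev b) e X)"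
proof (induction b arbitrary: c e X)
  case Nil
  have "coev [x] \<approx> Cup x"
  proof -
    have "Id [x] \<otimes> Id [] \<otimes> Id [x] \<approx> Id ([x] @ [] @ [x])"
      using mor_trans[OF tens_cong[OF mor_refl[OF hom_Id] tens_id] tens_id] by blast
    then have "(Id [x] \<otimes> Id [] \<otimes> Id [x]) \<odot> Cup x \<approx> Id [x, x] \<odot> Cup x"
      by (intro comp_cong[OF _ mor_refl[OF hom_Cup] _ hom_Cup]) (simp_all add: hom_def)
    then show ?thesis using mor_trans id_comp[OF hom_Cup] by (auto intro: mor_trans)
  qed
  moreover have "act c (Cup x) e (act c (Id []) e X) = act c (Cup x) e X"
    using act_cong[OF comp_id[OF hom_Cup], of c x e X] by (simp add: act_comp[OF hom_Cup hom_Id])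
  ultimately show ?case by (simp add: act_cong)
next
  case (Cons y b)
  show ?case
    using Cons[of "c @ [y]" "y # e"] act_coev_Cons[of c y b] act_coev_Cons[of c y "b @ [x]"]
    by simp
qed

text \<open>
  Peeling off the outermost cup of \<open>coev\<close> and the innermost cap of \<open>ev\<close> reduces this to a
  zigzag of one strand.
\<close>
lemma zigzag_word:
  assumes "X \<in> states (c @ w @ e)"
  shows "act (c @ w) (ev (rev w)) e (act c (coev w) (w @ e) X) = X"
  using assms
proof (induction w arbitrary: c)
  case Nil
  then show ?case using act_id[of X c "[]" e] by simp
next
  case (Cons y w)
  let ?Z = "act c (Cup y) (y # w @ e) X"
  have "act (c @ y # w) (ev (rev (y # w))) e (act c (coev (y # w)) ((y # w) @ e) X)
    = act (c @ y # w) (ev (rev w)) e (act (c @ y # w @ rev w) (Cap y) (w @ e)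
        (act (c @ [y]) (coev w) (y # y # w @ e) ?Z))"
    using act_ev_snoc[of "c @ y # w" "rev w" y e] act_coev_Cons[of c y w "y # w @ e" X]
    by simp
  also have "\<dots> = act (c @ y # w) (ev (rev w)) e (act (c @ [y]) (coev w) (w @ e)
        (act (c @ [y]) (Cap y) (w @ e) ?Z))"
    using act_exchange[where c = "c @ [y]" and d = "[]" and e = "w @ e" and X = ?Z, OF coev_hom hom_Cap, of w y] by simp
  also have "\<dots> = X"
    using zigzag_right_act[of X c y "w @ e"] Cons.IH[of "c @ [y]"] Cons.prems by simp
  finally show ?case .
qed

text \<open>
  The span of all states obtained from the states in \<open>N\<close> by splitting strands.  In the application
  \<open>N\<close> consists of states of reduced words, i.e. words satisfying \<open>distinct_adj\<close>.
\<close>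
inductive split_span :: "(obj \<Rightarrow> mor set \<Rightarrow> bool) \<Rightarrow> obj \<Rightarrow> mor set \<Rightarrow> bool" for N where
  base: "N w r \<Longrightarrow> split_span N w r"
| split: "split_span N (c @ a @ e) X \<Longrightarrow> splits h y a \<Longrightarrow> split_span N (c @ y # y # e) (act c h e X)"
| zero: "split_span N w (zer w)"
| add: "split_span N w X \<Longrightarrow> split_span N w Y \<Longrightarrow> split_span N w (add X Y)"
| scl: "split_span N w X \<Longrightarrow> split_span N w (scl k X)"

lemma overlap_cases:
  assumes "c' @ y # y # e' = c @ x # x # e"
  obtains (same) "c' = c" "y = x" "e' = e"
  | (right) "c' = c @ [x]" "y = x" "e = x # e'"
  | (left) "c = c' @ [x]" "y = x" "e' = x # e"
  | (far_right) d where "c' = c @ x # x # d" "e = d @ y # y # e'"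
  | (far_left) d where "c = c' @ y # y # d" "e' = d @ x # x # e"
  using assms by (auto simp: append_eq_append_conv2 append_eq_Cons_conv Cons_eq_append_conv)

context
  fixes N :: "obj \<Rightarrow> mor set \<Rightarrow> bool"
  assumes N: "\<forall>w r. N w r \<longrightarrow> distinct_adj w \<and> r \<in> states w"
begin

lemma split_span_states: "split_span N w X \<Longrightarrow> X \<in> states w"
proof (induction rule: split_span.induct)
  case (split c a e X h y)
  then show ?case using act_states[OF splits_hom] by fastforce
qed (use N in \<open>auto simp: zer_states add_states scl_states\<close>)

text \<open>
  The fusing layer is pushed down through the splitting layers.  Where it shares both strands or one
  strand with a splitting layer, a local relation rewrites the two layers as a combination of terms in
  which a fusing layer, if there is one, lies below a splitting layer, if there is one; where it shares
  none, the two layers are exchanged.  At the bottom it would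
  need two equal adjacent letters in a reduced word.
\<close>
lemma split_span_fuse:
  assumes "split_span N w X" "w = c @ x # x # e" "fuses g x b"
  shows "split_span N (c @ b @ e) (act c g e X)"
  using assms
proof (induction arbitrary: c x e g b rule: split_span.induct)
  case (base w r)
  then have "distinct_adj (c @ x # x # e)" using N by blast
  then show ?case by (simp add: distinct_adj_append_iff)
next
  case (split c' a e' X h y)
  note X = split_span_states[OF split.hyps(1)]
  from split.prems(1) show ?case
  proof (cases rule: overlap_cases)
    case same
    show ?thesis using \<open>splits h y a\<close>
    proof cases
      case 1
      obtain k where k: "act c (Cap x) e (act c (Cup x) e X) = scl k X"
        using cap_cup_scalar[of X c e x] X same 1 by auto
      show ?thesis using \<open>fuses g x b\<close> k X same split.hyps(1) 1
        by cases (simp_all add: m_cup_zero split_span.zero split_span.scl)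
    next
      case 2
      show ?thesis using \<open>fuses g x b\<close> 2 X same split.hyps(1)
        by cases (simp_all add: m_mstar cap_mstar_zero split_span.zero)
    qed
  next
    case right
    have IH: "split_span N (c @ b' @ e') (act c g' e' X)" if "fuses g' x' b'" "x' = x" "a = [x]" for g' x' b'
      using split.IH[of c x e' g' b'] that right by simp
    have X': "X \<in> states (c @ x # a @ e')" and S: "split_span N (c @ x # a @ e') X"
      using X split.hyps(1) right by simp_all
    have "split_span N (c @ b @ x # e') (act c g (x # e') (act (c @ [x]) h e' X))"
      using \<open>splits h y a\<close>
    proof cases
      case 1
      show ?thesis using \<open>fuses g x b\<close> 1 X' S right(2) split_span.split[OF _ splits.intros(2), of N c e' X]
        by cases (simp_all add: zigzag_left_act m_cup_right)
    next
      case 2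
      show ?thesis using \<open>fuses g x b\<close> 2 X' S right(2) IH[OF fuses.intros(2)] IH[OF fuses.intros(1)]
          split_span.split[OF _ splits.intros(1), of N c e' "act c (Cap Rho) e' X"]
        by cases (simp_all add: cap_mstar_right m_mstar_right split_span.add split_span.scl)
    qed
    then show ?thesis by (simp add: right)
  next
    case left
    have IH: "split_span N (c' @ b' @ e) (act c' g' e X)" if "fuses g' x' b'" "x' = x" "a = [x]" for g' x' b'
      using split.IH[of c' x e g' b'] that left by simp
    have X': "X \<in> states (c' @ a @ x # e)" and S: "split_span N (c' @ a @ x # e) X"
      using X split.hyps(1) left by simp_all
    have "split_span N (c' @ x # b @ e) (act (c' @ [x]) g e (act c' h (x # e) X))"
      using \<open>splits h y a\<close>
    proof cases
      case 1
      show ?thesis using \<open>fuses g x b\<close> 1 X' S left(2) split_span.split[OF _ splits.intros(2), of N c' e X]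
        by cases (simp_all add: zigzag_right_act mstar_eq_cup_m[symmetric])
    next
      case 2
      show ?thesis using \<open>fuses g x b\<close> 2 X' S left(2) IH[OF fuses.intros(2)] IH[OF fuses.intros(1)]
          split_span.split[OF _ splits.intros(1), of N c' e "act c' (Cap Rho) e X"]
        by cases (simp_all add: cap_mstar_left m_mstar_left split_span.add split_span.scl)
    qed
    then show ?thesis by (simp add: left)
  next
    case (far_right d)
    have "split_span N (c @ b @ d @ a @ e') (act c g (d @ a @ e') X)"
      using split.IH[OF _ split.prems(2), of c "d @ a @ e'"] far_right by simp
    then have "split_span N (c @ b @ d @ y # y # e')
        (act (c @ b @ d) h e' (act c g (d @ a @ e') X))"
      using split_span.split[OF _ split.hyps(2), of N "c @ b @ d" e'] by simp
    then show ?thesis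
      using act_exchange[where c = c and d = d and e = e' and X = X, OF fuses_hom[OF split.prems(2)] splits_hom[OF split.hyps(2)]] far_right
      by simp
  next
    case (far_left d)
    have "split_span N (c' @ a @ d @ b @ e) (act (c' @ a @ d) g e X)"
      using split.IH[OF _ split.prems(2), of "c' @ a @ d" e] far_left by simp
    then have "split_span N (c' @ y # y # d @ b @ e)
        (act c' h (d @ b @ e) (act (c' @ a @ d) g e X))"
      using split_span.split[OF _ split.hyps(2), of N c' "d @ b @ e"] by simp
    then show ?thesis
      using act_exchange[where c = c' and d = d and e = e and X = X, OF splits_hom[OF split.hyps(2)] fuses_hom[OF split.prems(2)]] far_left
      by simp
  qed
next
  case (zero w)
  then show ?case using act_zer[OF fuses_hom] split_span.zero by fastforce
next
  case (add w X Y)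
  then show ?case using act_add[OF fuses_hom] split_span.add split_span_states by fastforce
next
  case (scl w X k)
  then show ?case using act_scl[OF fuses_hom] split_span.scl split_span_states by fastforce
qed

lemma split_span_u_free:
  assumes "u_free T" "T \<in> hom n a b" "split_span N (c @ a @ e) X"
  shows "split_span N (c @ b @ e) (act c T e X)"
  using assms
proof (induction arbitrary: a b c e X)
  case (Id w)
  then show ?case using act_id[OF split_span_states] by (auto simp: hom_def)
next
  case (comp S T)
  then obtain d where d: "S \<in> hom n d b" "T \<in> hom n a d" using hom_compD by blast
  then show ?case using comp by (simp add: act_comp)
next
  case (tens S T)
  then obtain a1 b1 a2 b2 where d: "S \<in> hom n a1 b1" "T \<in> hom n a2 b2" "a = a1 @ a2" "b = b1 @ b2"
    by (auto simp: hom_def)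
  then have "split_span N (c @ a1 @ b2 @ e) (act (c @ a1) T e X)"
    using tens.IH(2)[of a2 b2 "c @ a1" e X] tens.prems by simp
  then show ?case using tens.IH(1)[of a1 b1 c "b2 @ e"] d by (simp add: act_tens(1))
next
  case (Cap x)
  then show ?case using split_span_fuse[OF _ _ fuses.intros(1), of _ X c x e] by (auto simp: hom_def)
next
  case GenM
  then show ?case using split_span_fuse[OF _ _ fuses.intros(2), of _ X c e] by (auto simp: hom_def)
next
  case (Cup x)
  then show ?case using split_span.split[OF _ splits.intros(1), of N c e X x] by (auto simp: hom_def)
next
  case GenMStar
  then show ?case using split_span.split[OF _ splits.intros(2), of N c e X] by (auto simp: hom_def)
qed

text \<open>
  To recognise a state with a word \<open>a @ rev a\<close> inside, fuse the strands from the middle outwards.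
  Each \<open>\<theta>\<close>-pair is a cap followed by a cup.  Each \<open>\<rho>\<close>-pair is a combination of a cap followed by a cup and
  of a vertex followed by its adjoint.  So it suffices to look at the state in which all pairs
  are capped, and at those in which the pairs of some suffix \<open>c\<close> are capped and the next pair is joined
  by a vertex.
\<close>
lemma split_span_cancel_pairs:
  assumes "X \<in> states (C @ a @ rev a @ E)"
    and "split_span N (C @ E) (act C (ev a) E X)"
    and "\<And>b c. a = b @ Rho # c \<Longrightarrow> split_span N (C @ b @ Rho # rev b @ E)
      (act (C @ b) GenM (rev b @ E) (act (C @ b @ [Rho]) (ev c) (Rho # rev b @ E) X))"
  shows "split_span N (C @ a @ rev a @ E) X"
  using assms
proof (induction a arbitrary: X rule: rev_induct)
  case Nil
  then show ?case using act_id[of X C "[]" E] by simp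
next
  case (snoc x b)
  let ?c = "C @ b" and ?e = "rev b @ E"
  define X' where "X' = act ?c (Cap x) ?e X"
  have X: "X \<in> states (?c @ x # x # ?e)" using snoc.prems(1) by simp
  have X': "X' \<in> states (C @ b @ rev b @ E)"
    using act_states[OF hom_Cap, of X ?c x ?e] X by (simp add: X'_def)
  have "split_span N (C @ b @ rev b @ E) X'"
  proof (rule snoc.IH[OF X'])
    show "split_span N (C @ E) (act C (ev b) E X')"
      using snoc.prems(2) by (simp add: X'_def act_ev_snoc)
    fix b' c assume b: "b = b' @ Rho # c"
    show "split_span N (C @ b' @ Rho # rev b' @ E)
      (act (C @ b') GenM (rev b' @ E) (act (C @ b' @ [Rho]) (ev c) (Rho # rev b' @ E) X'))"
      using snoc.prems(3)[of b' "c @ [x]"] by (simp add: X'_def act_ev_snoc b)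
  qed
  then have cup: "split_span N (?c @ x # x # ?e) (act ?c (Cup x) ?e X')"
    using split_span.split[OF _ splits.intros(1), of N ?c ?e X' x] by simp
  have "split_span N (?c @ x # x # ?e) X"
  proof (cases x)
    case Theta
    then show ?thesis using cup theta_cut_act[of X ?c ?e] X by (simp add: X'_def)
  next
    case Rho
    have "split_span N (?c @ [Rho] @ ?e) (act ?c GenM ?e X)"
      using snoc.prems(3)[of b "[]"] Rho X act_id[of X "C @ b @ [Rho]" "[]" "Rho # ?e"] by simp
    then have "split_span N (?c @ Rho # Rho # ?e) (act ?c GenMStar ?e (act ?c GenM ?e X))"
      by (rule split_span.split[OF _ splits.intros(2)])
    then have "split_span N (?c @ Rho # Rho # ?e) (add (scl (1 / \<tau>) (act ?c (Cup Rho) ?e X'))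
                 (act ?c GenMStar ?e (act ?c GenM ?e X)))"
      using cup Rho by (intro split_span.add split_span.scl) simp_all
    then show ?thesis using rho_fusion_act[of X ?c ?e] X Rho by (simp add: X'_def)
  qed
  then show ?case by simp
qed

end

section \<open>Bent generators\<close>

primrec other :: "colour \<Rightarrow> colour" where
  "other Theta = Rho"
| "other Rho = Theta"

text \<open>
  The alternating word of length \<open>2n\<close> that starts with \<open>s\<close>.
\<close>
definition half :: "colour \<Rightarrow> obj" where
  "half s = (case s of Rho \<Rightarrow> pow rt n | Theta \<Rightarrow> pow tr n)"

lemma other_other [simp]: "other (other s) = s"
  by (cases s) simp_all

lemma other_iff: "t \<noteq> s \<longleftrightarrow> t = other s"
  by (cases s; cases t) simp_all

lemma half_Rho: "half Rho = Rho # \<zeta> n"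
  and half_Theta: "half Theta = \<zeta> n @ [Rho]"
  using rho_zeta[OF n_pos] zeta_rho[OF n_pos] by (simp_all add: half_def)

lemma rev_half [simp]: "rev (half s) = half (other s)"
  by (cases s) (simp_all add: half_Rho half_Theta rev_zeta)

lemma half_not_Nil [simp]: "half s \<noteq> []"
  by (cases s) (simp_all add: half_Rho half_Theta)

text \<open>
  An alternating word of even length followed by its own first letter is alternating and can be regrouped.
\<close>
lemma half_slide: "half s @ s # w = s # half (other s) @ w"
proof (cases s)
  case Theta
  then show ?thesis
    using arg_cong[OF theta_pow_rt[of n], of "\<lambda>z. z @ w"] by (simp add: half_def)
qed (simp add: half_Rho half_Theta)

lemma pow_add: "pow w (j + k) = pow w j @ pow w k"
  by (simp add: pow_def replicate_add)

lemma distinct_adj_pow: "distinct_adj (Theta # pow rt k)" "distinct_adj (Rho # pow tr k)"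
  by (induction k) (simp_all add: pow_Suc rt_def tr_def)

lemma distinct_adj_half3: "distinct_adj (half s @ half s @ half s)"
proof -
  have "half s @ half s @ half s = (case s of Rho \<Rightarrow> pow rt (n + n + n) | Theta \<Rightarrow> pow tr (n + n + n))"
    by (simp add: half_def pow_add split: colour.split)
  moreover have "distinct_adj (pow rt k)" "distinct_adj (pow tr k)" for k
    by (rule distinct_adj_ConsD[OF distinct_adj_pow(1)], rule distinct_adj_ConsD[OF distinct_adj_pow(2)])
  ultimately show ?thesis by (simp split: colour.split)
qed

lemma distinct_adj_overlap:
  "distinct_adj (xs @ ys) \<Longrightarrow> distinct_adj (ys @ zs) \<Longrightarrow> ys \<noteq> [] \<Longrightarrow> distinct_adj (xs @ ys @ zs)"
  by (auto simp: distinct_adj_append_iff)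

lemma distinct_adj_half2: "distinct_adj (half s @ half s)"
  using distinct_adj_half3[of s] by (auto simp: distinct_adj_append_iff)

text \<open>
  The two generators, and their forms with all legs bent to the top, are indexed by the colour of
  their leftmost target strand.
\<close>
primrec genU :: "colour \<Rightarrow> mor" where
  "genU Rho = GenUStar"
| "genU Theta = GenU"

primrec bentU :: "colour \<Rightarrow> mor" where
  "bentU Rho = adj (u_mor n)"
| "bentU Theta = adj (v_mor n)"

declare bentU.simps [simp del]

lemma adj_ev [simp]: "adj (ev w) = coev w"
  and adj_coev [simp]: "adj (coev w) = ev w"
  by (induction w) simp_all

lemma genU_hom: "genU s \<in> hom n (half (other s)) (half s)"
  by (cases s) (simp_all add: hom_def half_def)

lemma half_ev_hom: "ev (half s) \<in> hom n (half s @ half (other s)) []"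
  and half_coev_hom: "coev (half s) \<in> hom n [] (half s @ half (other s))"
  using ev_hom[of "half s" n] coev_hom[of "half s" n] by simp_all

lemma bentU_eq: "bentU s = (genU s \<otimes> Id (half s)) \<odot> coev (half (other s))"
  by (cases s) (simp_all add: bentU.simps u_mor_def v_mor_def half_Rho half_Theta)

lemma bentU_hom: "bentU s \<in> hom n [] (half s @ half s)"
  unfolding bentU_eq using hom_comp[OF hom_tens[OF genU_hom hom_Id] ] half_coev_hom[of "other s"] by simp

lemma act_bentU: "act c (bentU s) e X = act c (genU s) (half s @ e) (act c (coev (half (other s))) e X)"
  unfolding bentU_eq
  using act_comp[OF hom_tens[OF genU_hom hom_Id[of "half s"]], of "coev (half (other s))" "[]" s c e X]
    half_coev_hom[of "other s"]
  by (simp add: act_tens_id[OF genU_hom])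

lemma genU_genU:
  assumes "X \<in> states (c @ half s @ e)"
  shows "act c (genU s) e (act c (genU (other s)) e X) = X"
proof -
  have "genU s \<odot> genU (other s) \<approx> Id (half s)"
    using of_skein[OF unitary_left] of_skein[OF unitary_right]
    by (cases s) (simp_all add: half_Rho half_Theta)
  from act_cong[OF this, of c e X] show ?thesis
    using act_comp[OF genU_hom genU_hom[of "other s", simplified], of c e X] act_id[OF assms] by simp
qed

text \<open>
  By the zigzag identity.  This reduces stacking a generator on a state to inserting a bent one.
\<close>
lemma genU_via_bentU:
  assumes "X \<in> states (c @ half (other s) @ e)"
  shows "act c (genU s) e X = act (c @ half s) (ev (half s)) e (act c (bentU s) (half (other s) @ e) X)"
  using act_exchange[where c = c and d = "[]" and e = e, OF genU_hom half_ev_hom, of s s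
      "act c (coev (half (other s))) (half (other s) @ e) X"] zigzag_word[OF assms]
  by (simp add: act_bentU)

text \<open>
  Joining the right half of one bent generator with the left half of a neighbour of the other kind
  composes a generator with its inverse.
\<close>
lemma bentU_ev_bentU:
  assumes "r \<in> states (A @ e)"
  shows "act (A @ half s) (ev (half s)) (half (other s) @ e)
      (act (A @ half s @ half s) (bentU (other s)) e (act A (bentU s) e r)) = act A (coev (half s)) e r"
proof -
  let ?s = "half s" and ?o = "half (other s)"
  let ?V = "act A (coev ?o) e r" and ?W = "act A (coev ?s) e r"
  have W: "?W \<in> states (A @ ?s @ ?o @ e)"
    using act_states[OF half_coev_hom, of r A e s] assms by simp
  have Q: "act A (genU (other s)) (?o @ e) ?W \<in> states (A @ ?o @ ?o @ e)"
    using act_states[OF genU_hom, of ?W A "other s" "?o @ e"] W by simp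
  have "act (A @ ?s) (ev ?s) (?o @ e) (act (A @ ?s @ ?s) (bentU (other s)) e (act A (bentU s) e r))
    = act (A @ ?s) (ev ?s) (?o @ e) (act (A @ ?s @ ?s) (genU (other s)) (?o @ e)
        (act (A @ ?s @ ?s) (coev ?s) e (act A (genU s) (?s @ e) ?V)))"
    by (simp add: act_bentU)
  also have "\<dots> = act (A @ ?s) (ev ?s) (?o @ e) (act (A @ ?s @ ?s) (genU (other s)) (?o @ e)
        (act A (genU s) (?s @ ?s @ ?o @ e) (act (A @ ?o @ ?s) (coev ?s) e ?V)))"
    using act_exchange[where c = A and d = ?s and e = e, OF genU_hom half_coev_hom, of s s ?V] by simp
  also have "\<dots> = act (A @ ?s) (ev ?s) (?o @ e) (act A (genU s) (?s @ ?o @ ?o @ e)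
        (act (A @ ?o @ ?s) (genU (other s)) (?o @ e) (act (A @ ?o @ ?s) (coev ?s) e ?V)))"
    using act_exchange[where c = A and d = ?s and e = "?o @ e", OF genU_hom genU_hom, of s "other s"] by simp
  also have "\<dots> = act A (genU s) (?o @ e) (act (A @ ?o) (ev ?s) (?o @ e)
        (act (A @ ?o @ ?s) (genU (other s)) (?o @ e) (act (A @ ?o @ ?s) (coev ?s) e ?V)))"
    using act_exchange[where c = A and d = "[]" and e = "?o @ e", OF genU_hom half_ev_hom, of s s] by simp
  also have "act (A @ ?o @ ?s) (coev ?s) e ?V = act A (coev ?o) (?s @ ?o @ e) ?W"
    using act_exchange[where c = A and d = "[]" and e = e, OF half_coev_hom half_coev_hom, of "other s" s r]
    by simp
  also have "act (A @ ?o @ ?s) (genU (other s)) (?o @ e) (act A (coev ?o) (?s @ ?o @ e) ?W)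
      = act A (coev ?o) (?o @ ?o @ e) (act A (genU (other s)) (?o @ e) ?W)"
    using act_exchange[where c = A and d = "[]" and e = "?o @ e", OF half_coev_hom genU_hom, of "other s" "other s" ?W]
    by simp
  also have "act (A @ ?o) (ev ?s) (?o @ e) (act A (coev ?o) (?o @ ?o @ e) (act A (genU (other s)) (?o @ e) ?W))
      = act A (genU (other s)) (?o @ e) ?W"
    using zigzag_word[OF Q] by simp
  also have "act A (genU s) (?o @ e) (act A (genU (other s)) (?o @ e) ?W) = ?W"
    using genU_genU W by simp
  finally show ?thesis .
qed

section \<open>Chains of bent generators\<close>

text \<open>
  A link places a further bent generator to the right of a chain and lets a \<open>U\<close>-free diagram \<open>G\<close> act on
  the chain and on the left half of the new generator.  The right half stays untouched, so that it
  is available for the next link and the target word of a nonempty chain is nonempty.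
\<close>
inductive chain :: "obj \<Rightarrow> mor set \<Rightarrow> bool" where
  empty: "chain [] vac"
| link: "chain A r \<Longrightarrow> u_free G \<Longrightarrow> G \<in> hom n (A @ half s) C \<Longrightarrow> distinct_adj (C @ half s) \<Longrightarrow>
    chain (C @ half s) (act [] G (half s) (act A (bentU s) [] r))"

lemma chain_state: "chain A r \<Longrightarrow> distinct_adj A \<and> r \<in> states A"
proof (induction rule: chain.induct)
  case empty
  then show ?case by (simp add: vac_states)
next
  case (link A r G s C)
  then have "act A (bentU s) [] r \<in> states (A @ half s @ half s)"
    using act_states[OF bentU_hom, of r A "[]" s] by simp
  then show ?case using link act_states[OF link.hyps(3), of _ "[]" "half s"] by simp
qed

abbreviation jelly :: "obj \<Rightarrow> mor set \<Rightarrow> bool" where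
  "jelly \<equiv> split_span chain"

lemma chain_states: "\<forall>A r. chain A r \<longrightarrow> distinct_adj A \<and> r \<in> states A"
  using chain_state by blast

lemmas jelly_states = split_span_states[OF chain_states]
  and jelly_u_free = split_span_u_free[OF chain_states]
  and jelly_cancel_pairs = split_span_cancel_pairs[OF chain_states]

text \<open>
  If the new generator is of the same kind as the last one, its first letter differs from the
  last letter of the chain and this is a longer chain.  If it is of the other kind, the right half \<open>a\<close> of
  the last generator meets \<open>rev a\<close>, and \<open>split_span_cancel_pairs\<close> applies.  Completely capped, both generators
  cancel and the previous chain with a \<open>U\<close>-free diagram on it remains.  With a vertex
  as outermost connection, the resulting word is reduced and this is a link.
\<close>
lemma jelly_append_chain:
  assumes "chain A r"
  shows "jelly (A @ half t @ half t) (act A (bentU t) [] r)"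
  using assms
proof cases
  case empty
  have "bentU t \<in> hom n [] (half t @ half t)" by (rule bentU_hom)
  then have S: "act [] (bentU t) [] vac \<in> states ([] @ half t @ half t)"
    using act_states[of "bentU t" "[]" _ vac "[]" "[]"] vac_states by simp
  have "chain (half t @ half t) (act [] (Id (half t)) (half t) (act [] (bentU t) [] vac))"
    using link[OF chain.empty u_free.Id, of "half t" t "half t"] distinct_adj_half2 by (simp add: hom_Id)
  then show ?thesis using empty act_id[OF S] by (simp add: split_span.base)
next
  case (link A' r' G s C)
  note rA = chain_state[OF assms]
  have X: "act A (bentU t) [] r \<in> states (A @ half t @ half t)"
    using act_states[OF bentU_hom, of r A "[]" t] rA by simp
  show ?thesis
  proof (cases "t = s")
    case True
    have "distinct_adj (C @ half s @ half s @ half s)"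
      using distinct_adj_overlap[OF link(6), of "half s @ half s"] distinct_adj_half3 by simp
    then have "chain (A @ half s @ half s) (act [] (Id (A @ half s)) (half s) (act A (bentU s) [] r))"
      using chain.link[OF assms u_free.Id hom_Id, of s] link by simp
    then show ?thesis using act_id[of _ "[]" "A @ half s" "half s"] X True by (simp add: split_span.base)
  next
    case False
    then have t: "t = other s" by (simp add: other_iff)
    let ?s = "half s" and ?o = "half (other s)"
    let ?Y = "act A' (bentU s) [] r'" and ?X = "act (C @ ?s) (bentU t) [] r"
    have r': "r' \<in> states A'" "jelly A' r'" using link(3) chain_state split_span.base by blast+
    have "jelly (C @ ?s @ rev ?s @ ?o) ?X"
    proof (rule jelly_cancel_pairs)
      show "?X \<in> states (C @ ?s @ rev ?s @ ?o)" using X t link by simp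
      have "act C (ev ?s) ?o ?X = act C (ev ?s) ?o (act [] G (?s @ ?o @ ?o) (act (A' @ ?s @ ?s) (bentU t) [] ?Y))"
        using act_exchange[where c = "[]" and d = ?s and e = "[]", OF link(5) bentU_hom, of t ?Y] link(2) t by simp
      also have "\<dots> = act [] G ?o (act (A' @ ?s) (ev ?s) ?o (act (A' @ ?s @ ?s) (bentU t) [] ?Y))"
        using act_exchange[where c = "[]" and d = "[]" and e = ?o, OF link(5) half_ev_hom, of s] by simp
      also have "\<dots> = act [] G ?o (act A' (coev ?s) [] r')"
        using bentU_ev_bentU[of r' A' "[]" s] r' t by simp
      finally have *: "act C (ev ?s) ?o ?X = act [] G ?o (act A' (coev ?s) [] r')" .
      have "jelly (A' @ ?s @ ?o) (act A' (coev ?s) [] r')"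
        using jelly_u_free[OF u_free_coev half_coev_hom, of A' "[]" r' s] r' by simp
      then show "jelly (C @ ?o) (act C (ev ?s) ?o ?X)"
        using jelly_u_free[OF link(4,5), of "[]" ?o] * by simp
    next
      fix b c assume s: "?s = b @ Rho # c"
      have o: "?o = rev c @ Rho # rev b" using arg_cong[OF s, of rev] by simp
      let ?F = "Id (C @ b) \<otimes> GenM \<otimes> Id (rev b)"
      let ?E = "Id (C @ b @ [Rho]) \<otimes> ev c \<otimes> Id (Rho # rev b)"
      have F: "?F \<in> hom n (C @ b @ Rho # Rho # rev b) (C @ b @ Rho # rev b)"
        using hom_tens[OF hom_Id hom_tens[OF hom_GenM hom_Id], of "C @ b" "rev b"] by simp
      have E: "?E \<in> hom n (C @ b @ Rho # c @ rev c @ Rho # rev b) (C @ b @ Rho # Rho # rev b)"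
        using hom_tens[OF hom_Id hom_tens[OF ev_hom[of c n] hom_Id], of "C @ b @ [Rho]" "Rho # rev b"] by simp
      have "distinct_adj (C @ b @ [Rho])"
        using link(6) unfolding s by (auto simp: distinct_adj_append_iff hd_append)
      moreover have "distinct_adj (Rho # rev b @ ?o)"
        using distinct_adj_half2[of "other s"] unfolding o by (auto simp: distinct_adj_append_iff)
      ultimately have "distinct_adj (C @ b @ Rho # rev b @ ?o)"
        using distinct_adj_overlap[of "C @ b" "[Rho]" "rev b @ ?o"] by simp
      moreover have "A @ half t = C @ b @ Rho # c @ rev c @ Rho # rev b"
        by (simp add: link(1) t s o del: append_assoc)
      then have "?F \<odot> ?E \<in> hom n (A @ half t) (C @ b @ Rho # rev b)"
        using hom_comp[OF F E] by simp
      ultimately have "chain (C @ b @ Rho # rev b @ ?o) (act [] (?F \<odot> ?E) ?o ?X)"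
        using chain.link[OF assms, of "?F \<odot> ?E" t "C @ b @ Rho # rev b"]
        by (simp add: u_free.intros u_free_ev link(1) t)
      moreover have "act [] (?F \<odot> ?E) ?o ?X = act (C @ b) GenM (rev b @ ?o)
          (act (C @ b @ [Rho]) (ev c) (Rho # rev b @ ?o) ?X)"
        using act_comp[OF F E, of "[]" ?o ?X]
        by (simp add: act_id_tens[OF hom_tens[OF hom_GenM hom_Id]] act_tens_id[OF hom_GenM]
            act_id_tens[OF hom_tens[OF ev_hom hom_Id]] act_tens_id[OF ev_hom])
      ultimately show "jelly (C @ b @ Rho # rev b @ ?o) (act (C @ b) GenM (rev b @ ?o)
          (act (C @ b @ [Rho]) (ev c) (Rho # rev b @ ?o) ?X))"
        using split_span.base[of chain] by simp
    qed
    then show ?thesis using t link by simp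
  qed
qed

lemma jelly_append:
  "jelly w X \<Longrightarrow> jelly (w @ half t @ half t) (act w (bentU t) [] X)"
proof (induction rule: split_span.induct)
  case (base w r)
  then show ?case by (rule jelly_append_chain)
next
  case (split c a e X h y)
  have "jelly (c @ a @ e @ half t @ half t) (act (c @ a @ e) (bentU t) [] X)" using split.IH by simp
  then have "jelly (c @ y # y # e @ half t @ half t)
      (act c h (e @ half t @ half t) (act (c @ a @ e) (bentU t) [] X))"
    by (rule split_span.split[OF _ split.hyps(2)])
  then show ?case
    using act_exchange[where c = c and d = e and e = "[]" and X = X, OF splits_hom[OF split.hyps(2)] bentU_hom[of t]]
    by simp
next
  case (zero w)
  show ?case using act_zer[OF bentU_hom, of w t "[]"] split_span.zero by simp
next
  case (add w X Y)
  have "X \<in> states w" "Y \<in> states w" using add jelly_states by blast+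
  then show ?case using act_add[OF bentU_hom, of X w "[]" Y t] split_span.add[OF add.IH] by simp
next
  case (scl w X k)
  have "X \<in> states w" using scl jelly_states by blast
  then show ?case using act_scl[OF bentU_hom, of X w "[]" t k] split_span.scl[OF scl.IH] by simp
qed

section \<open>Moving a bent generator through strands\<close>

lemma jellyfish_theta_act:
  "act (a @ [Theta]) (bentU Rho) (Theta # e) (act a (Cup Theta) e X)
    = act a (bentU Theta) (Theta # Theta # e) (act a (Cup Theta) e X)"
proof -
  have H: "Id [Theta] \<otimes> bentU Rho \<otimes> Id [Theta]
      \<in> hom n [Theta, Theta] ([Theta] @ (half Rho @ half Rho) @ [Theta])"
    using hom_tens[OF hom_Id hom_tens[OF bentU_hom hom_Id], of "[Theta]" Rho "[Theta]"] by simp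
  have "(Id [Theta] \<otimes> bentU Rho \<otimes> Id [Theta]) \<odot> Cup Theta \<approx> bentU Theta \<otimes> Cup Theta"
    using adj_cong[OF of_skein[OF jellyfish_theta]] by (simp add: bentU.simps)
  from act_cong[OF this, of a e X] show ?thesis
    by (simp add: act_comp[OF H hom_Cup] act_id_tens[OF hom_tens[OF bentU_hom hom_Id]]
        act_tens_id[OF bentU_hom] act_tens(1)[OF bentU_hom hom_Cup])
qed

lemma u_free_adj: "u_free T \<Longrightarrow> u_free (adj T)"
  by (induction rule: u_free.induct) (simp_all add: u_free.intros)

text \<open>
  The adjoint of the last jellyfish relation; \<open>D\<close> is the adjoint of the \<open>U\<close>-free diagram in its second
  summand.
\<close>
lemma jellyfish_rho_act:
  obtains k l D where "u_free D"
    and "D \<in> hom n (half Rho @ half Rho @ half Theta @ half Theta) ([Rho, Rho] @ half Theta @ half Theta)"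
    and "\<And>a e X. X \<in> states (a @ e) \<Longrightarrow> act (a @ [Rho]) (bentU Rho) (Rho # e) (act a (Cup Rho) e X)
      = add (scl k (act a (Cup Rho) (half Theta @ half Theta @ e) (act a (bentU Theta) e X)))
         (scl l (act a D e (act a (bentU Rho) (half Theta @ half Theta @ e) (act a (bentU Theta) e X))))"
proof -
  let ?B = "GenM \<otimes> Id (\<zeta> n) \<otimes> M_mor n \<otimes> Id (\<zeta> n @ [Rho])"
  have Y: "Y_mor \<in> hom n [Rho] [Rho, Rho]" by (simp add: Y_mor_def hom_def)
  have "Id [Rho] \<otimes> coev (\<zeta> n) \<otimes> Id [Rho] \<in> hom n [Rho, Rho] (Rho # \<zeta> n @ \<zeta> n @ [Rho])"
    using hom_tens[OF hom_Id hom_tens[OF coev_hom[of "\<zeta> n" n] hom_Id], of "[Rho]" "[Rho]"]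
    by (simp add: rev_zeta)
  from hom_comp[OF this Y] have "M_mor n \<in> hom n [Rho] (Rho # \<zeta> n @ \<zeta> n @ [Rho])"
    by (simp add: M_mor_def)
  from hom_tens[OF hom_GenM hom_tens[OF hom_Id hom_tens[OF this hom_Id]], of "\<zeta> n" "\<zeta> n @ [Rho]"]
  have B: "?B \<in> hom n ([Rho, Rho] @ half Theta @ half Theta)
      (half Rho @ half Rho @ half Theta @ half Theta)"
    by (simp add: half_Rho half_Theta)
  have "u_free ?B" by (simp add: M_mor_def Y_mor_def u_free.intros u_free_coev)
  then have D: "u_free (adj ?B)" by (rule u_free_adj)
  note D_hom = adj_hom[OF B]
  have H: "Id [Rho] \<otimes> bentU Rho \<otimes> Id [Rho] \<in> hom n [Rho, Rho] ([Rho] @ (half Rho @ half Rho) @ [Rho])"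
    using hom_tens[OF hom_Id hom_tens[OF bentU_hom hom_Id], of "[Rho]" Rho "[Rho]"] by simp
  have J: "bentU Rho \<otimes> bentU Theta \<in> hom n [] (half Rho @ half Rho @ half Theta @ half Theta)"
    using hom_tens[OF bentU_hom bentU_hom, of Rho Theta] by simp
  have CJ: "Cup Rho \<otimes> bentU Theta \<in> hom n [] ([Rho, Rho] @ half Theta @ half Theta)"
    using hom_tens[OF hom_Cup bentU_hom, of Rho Theta] by simp
  have "(Id [Rho] \<otimes> bentU Rho \<otimes> Id [Rho]) \<odot> Cup Rho
      \<approx> cnj (\<omega> / \<tau>) \<bullet> (Cup Rho \<otimes> bentU Theta) \<oplus> cnj (inverse \<sigma>) \<bullet> (adj ?B \<odot> (bentU Rho \<otimes> bentU Theta))"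
    using adj_cong[OF of_skein[OF jellyfish_rho]] by (simp add: bentU.simps)
  from act_cong[OF this]
  have "act (a @ [Rho]) (bentU Rho) (Rho # e) (act a (Cup Rho) e X)
      = act a (cnj (\<omega> / \<tau>) \<bullet> (Cup Rho \<otimes> bentU Theta) \<oplus> cnj (inverse \<sigma>) \<bullet> (adj ?B \<odot> (bentU Rho \<otimes> bentU Theta))) e X"
    for a e X
    by (simp del: adj.simps add: act_comp[OF H hom_Cup] act_id_tens[OF hom_tens[OF bentU_hom hom_Id]]
        act_tens_id[OF bentU_hom])
  then have "act (a @ [Rho]) (bentU Rho) (Rho # e) (act a (Cup Rho) e X)
      = add (scl (cnj (\<omega> / \<tau>)) (act a (Cup Rho) (half Theta @ half Theta @ e) (act a (bentU Theta) e X)))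
         (scl (cnj (inverse \<sigma>)) (act a (adj ?B) e (act a (bentU Rho) (half Theta @ half Theta @ e) (act a (bentU Theta) e X))))"
    if "X \<in> states (a @ e)" for a e X
    using act_Plus[OF hom_scale[OF CJ] hom_scale[OF hom_comp[OF D_hom J]], of X a e]
      act_Scale[OF CJ, of X a e] act_Scale[OF hom_comp[OF D_hom J], of X a e] that
    by (simp add: act_comp[OF D_hom J] act_tens(1)[OF bentU_hom bentU_hom] act_tens(1)[OF hom_Cup bentU_hom]
        del: adj.simps)
  from that[OF D D_hom this] show ?thesis .
qed

text \<open>
  Bending the leftmost \<open>\<rho>\<close>-leg of the bent \<open>GenUStar\<close> around to the right gives the bent \<open>GenU\<close>, up to a
  scalar; this is the adjoint of the rotation relation.
\<close>
lemma bentU_rotation: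
  obtains k where "\<And>a e X. X \<in> states (a @ e) \<Longrightarrow> act a (bentU Theta) e X
    = scl k (act a (Cap Rho) (half Theta @ half Theta @ e)
        (act (a @ [Rho]) (bentU Rho) (Rho # e) (act a (Cup Rho) e X)))"
proof -
  let ?k = "cnj (inverse \<omega>)"
  let ?F = "Cap Rho \<otimes> Id (half Theta)" and ?U = "Id [Rho] \<otimes> GenUStar \<otimes> Id [Rho]"
    and ?C = "Id (half Rho) \<otimes> Cup Rho"
  have G: "GenUStar \<in> hom n (half Theta) (half Rho)" using genU_hom[of Rho] by simp
  have F: "?F \<in> hom n (Rho # Rho # half Theta) (half Theta)"
    using hom_tens[OF hom_Cap hom_Id, of Rho "half Theta"] by simp
  have U: "?U \<in> hom n (Rho # half Theta @ [Rho]) (Rho # Rho # half Theta)"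
    using hom_tens[OF hom_Id hom_tens[OF G hom_Id], of "[Rho]" "[Rho]"] by (simp add: half_Rho half_Theta)
  have C: "?C \<in> hom n (half Rho) (Rho # half Theta @ [Rho])"
    using hom_tens[OF hom_Id hom_Cup, of "half Rho" Rho] by (simp add: half_Rho half_Theta)
  have UF: "(?F \<odot> ?U) \<odot> ?C \<in> hom n (half Rho) (half Theta)"
    by (rule hom_comp[OF hom_comp[OF F U] C])
  have *: "GenU \<approx> ?k \<bullet> ((?F \<odot> ?U) \<odot> ?C)"
    using adj_cong[OF of_skein[OF rotation]] by (simp add: rotU_def half_Rho half_Theta)
  have "act a (bentU Theta) e X = scl ?k (act a (Cap Rho) (half Theta @ half Theta @ e)
        (act (a @ [Rho]) (bentU Rho) (Rho # e) (act a (Cup Rho) e X)))"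
    if X: "X \<in> states (a @ e)" for a e X
  proof -
    let ?Z = "act a (coev (half Rho)) e X"
    have Z: "?Z \<in> states (a @ half Rho @ half Theta @ e)"
      using act_states[OF half_coev_hom, of X a e Rho] X by simp
    have snoc: "half Rho @ [Rho] = Rho # half Theta" by (simp add: half_Rho half_Theta)
    have "act (a @ half Rho) (Cup Rho) (half Theta @ e) ?Z = act a (coev (half Rho @ [Rho])) e X"
      by (simp add: act_coev_snoc)
    also have "\<dots> = act (a @ [Rho]) (coev (half Theta)) (Rho # e) (act a (Cup Rho) e X)"
      by (simp only: snoc act_coev_Cons)
    finally have cups: "act (a @ half Rho) (Cup Rho) (half Theta @ e) ?Z
      = act (a @ [Rho]) (coev (half Theta)) (Rho # e) (act a (Cup Rho) e X)" .
    have "act a (bentU Theta) e X = act a GenU (half Theta @ e) ?Z" by (simp add: act_bentU)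
    also have "\<dots> = scl ?k (act a ((?F \<odot> ?U) \<odot> ?C) (half Theta @ e) ?Z)"
      using act_cong[OF *] act_Scale[OF UF Z] by simp
    also have "act a ((?F \<odot> ?U) \<odot> ?C) (half Theta @ e) ?Z
      = act a (Cap Rho) (half Theta @ half Theta @ e) (act (a @ [Rho]) GenUStar (Rho # half Theta @ e)
          (act (a @ [Rho]) (coev (half Theta)) (Rho # e) (act a (Cup Rho) e X)))"
      by (simp add: act_comp[OF hom_comp[OF F U] C] act_comp[OF F U] act_tens_id[OF hom_Cap]
          act_id_tens[OF hom_tens[OF G hom_Id]] act_tens_id[OF G] act_id_tens[OF hom_Cup] cups)
    also have "\<dots> = act a (Cap Rho) (half Theta @ half Theta @ e)
        (act (a @ [Rho]) (bentU Rho) (Rho # e) (act a (Cup Rho) e X))"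
      by (simp add: act_bentU half_Rho half_Theta)
    finally show ?thesis .
  qed
  from that[OF this] show ?thesis .
qed

lemma jelly_Cup: "jelly (c @ e) X \<Longrightarrow> jelly (c @ x # x # e) (act c (Cup x) e X)"
  using split_span.split[OF _ splits.intros(1), of chain c e X x] by simp

lemma jelly_Cap: "jelly (c @ x # x # e) X \<Longrightarrow> jelly (c @ e) (act c (Cap x) e X)"
  using jelly_u_free[OF u_free.Cap hom_Cap, of c x e X] by simp

text \<open>
  The hypothesis \<open>IH\<close> here and in the next two lemmas allows inserting bent generators to the
  right of the next strand, where only the strands \<open>e\<close> remain to be crossed.  Bending the
  \<open>\<theta>\<close>-strand creates the cup that the jellyfish relation requires.
\<close>
lemma jelly_insert_theta:
  assumes IH: "\<And>a X s. jelly (a @ e) X \<Longrightarrow> jelly (a @ half s @ half s @ e) (act a (bentU s) e X)"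
    and X: "jelly (a @ Theta # e) X"
  shows "jelly (a @ half s @ half s @ Theta # e) (act a (bentU s) (Theta # e) X)"
proof (cases s)
  case Rho
  let ?h = "half Theta" and ?Z = "act (a @ [Theta]) (Cup Theta) e X"
  have "act a (bentU Rho) (Theta # e) X = act a (bentU Rho) (Theta # e) (act a (Cap Theta) (Theta # e) ?Z)"
    using zigzag_left_act[of X a Theta e] jelly_states[OF X] by simp
  also have "\<dots> = act a (Cap Theta) (half Rho @ half Rho @ Theta # e)
      (act (a @ [Theta, Theta]) (bentU Rho) (Theta # e) ?Z)"
    using act_exchange[where c = a and d = "[]" and e = "Theta # e", OF hom_Cap bentU_hom, of Theta Rho ?Z] by simp
  also have "act (a @ [Theta, Theta]) (bentU Rho) (Theta # e) ?Z
      = act (a @ [Theta]) (bentU Theta) (Theta # Theta # e) ?Z"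
    using jellyfish_theta_act[of "a @ [Theta]" e X] by simp
  also have "\<dots> = act (a @ Theta # ?h @ ?h) (Cup Theta) e (act (a @ [Theta]) (bentU Theta) e X)"
    using act_exchange[where c = "a @ [Theta]" and d = "[]" and e = e, OF bentU_hom hom_Cup, of Theta Theta X] by simp
  finally have *: "act a (bentU Rho) (Theta # e) X = act a (Cap Theta) (half Rho @ half Rho @ Theta # e)
      (act (a @ Theta # ?h @ ?h) (Cup Theta) e (act (a @ [Theta]) (bentU Theta) e X))" .
  have "jelly (a @ Theta # ?h @ ?h @ e) (act (a @ [Theta]) (bentU Theta) e X)"
    using IH[of "a @ [Theta]" X Theta] X by simp
  then have "jelly (a @ Theta # ?h @ ?h @ Theta # Theta # e)
      (act (a @ Theta # ?h @ ?h) (Cup Theta) e (act (a @ [Theta]) (bentU Theta) e X))"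
    using jelly_Cup[of "a @ Theta # ?h @ ?h" e _ Theta] by simp
  moreover have "Theta # ?h @ ?h @ Theta # Theta # e = Theta # Theta # half Rho @ half Rho @ Theta # e"
    by (simp add: half_slide)
  ultimately show ?thesis using jelly_Cap[of a Theta "half Rho @ half Rho @ Theta # e"] * Rho by simp
next
  case Theta
  let ?Z = "act a (Cup Theta) (Theta # e) X"
  have "act a (bentU Theta) (Theta # e) X = act a (bentU Theta) (Theta # e) (act (a @ [Theta]) (Cap Theta) e ?Z)"
    using zigzag_right_act[of X a Theta e] jelly_states[OF X] by simp
  also have "\<dots> = act (a @ half Theta @ half Theta @ [Theta]) (Cap Theta) e
      (act a (bentU Theta) (Theta # Theta # Theta # e) ?Z)"
    using act_exchange[where c = a and d = "[Theta]" and e = e, OF bentU_hom hom_Cap, of Theta Theta ?Z] by simp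
  also have "act a (bentU Theta) (Theta # Theta # Theta # e) ?Z
      = act (a @ [Theta]) (bentU Rho) (Theta # Theta # e) ?Z"
    using jellyfish_theta_act[of a "Theta # e" X] by simp
  also have "act (a @ half Theta @ half Theta @ [Theta]) (Cap Theta) e
      (act (a @ [Theta]) (bentU Rho) (Theta # Theta # e) ?Z)
      = act (a @ [Theta]) (bentU Rho) e (act (a @ [Theta]) (Cap Theta) e ?Z)"
    using act_exchange[where c = "a @ [Theta]" and d = "[]" and e = e, OF bentU_hom hom_Cap, of Rho Theta ?Z]
    by (simp add: half_slide)
  also have "\<dots> = act (a @ [Theta]) (bentU Rho) e X"
    using zigzag_right_act[of X a Theta e] jelly_states[OF X] by simp
  finally show ?thesis using IH[of "a @ [Theta]" X Rho] X Theta by (simp add: half_slide)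
qed

text \<open>
  The \<open>\<rho>\<close>-strand is bent to create a cup, and the jellyfish relation is applied.  In its second
  summand two generators lie to the right of the strand; the \<open>u\<close>-type one is inserted first, so that
  the hypothesis applies to both.
\<close>
lemma jelly_insert_rho_Rho:
  assumes IH: "\<And>a X s. jelly (a @ e) X \<Longrightarrow> jelly (a @ half s @ half s @ e) (act a (bentU s) e X)"
    and X: "jelly (a @ Rho # e) X"
  shows "jelly (a @ half Rho @ half Rho @ Rho # e) (act a (bentU Rho) (Rho # e) X)"
proof -
  obtain k l D where D: "u_free D"
      "D \<in> hom n (half Rho @ half Rho @ half Theta @ half Theta) ([Rho, Rho] @ half Theta @ half Theta)"
    and *: "\<And>a e X. X \<in> states (a @ e) \<Longrightarrow> act (a @ [Rho]) (bentU Rho) (Rho # e) (act a (Cup Rho) e X)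
      = add (scl k (act a (Cup Rho) (half Theta @ half Theta @ e) (act a (bentU Theta) e X)))
         (scl l (act a D e (act a (bentU Rho) (half Theta @ half Theta @ e) (act a (bentU Theta) e X))))"
    using jellyfish_rho_act by metis
  let ?t = "half Theta @ half Theta" and ?r = "half Rho @ half Rho"
  let ?Z = "act (a @ [Rho]) (Cup Rho) e X" and ?V = "act (a @ [Rho]) (bentU Theta) e X"
  have "act a (bentU Rho) (Rho # e) X = act a (bentU Rho) (Rho # e) (act a (Cap Rho) (Rho # e) ?Z)"
    using zigzag_left_act[of X a Rho e] jelly_states[OF X] by simp
  also have "\<dots> = act a (Cap Rho) (?r @ Rho # e) (act (a @ [Rho, Rho]) (bentU Rho) (Rho # e) ?Z)"
    using act_exchange[where c = a and d = "[]" and e = "Rho # e", OF hom_Cap bentU_hom, of Rho Rho ?Z] by simp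
  finally have eq: "act a (bentU Rho) (Rho # e) X
    = act a (Cap Rho) (?r @ Rho # e) (act (a @ [Rho, Rho]) (bentU Rho) (Rho # e) ?Z)" .
  have V: "jelly (a @ Rho # ?t @ e) ?V" using IH[of "a @ [Rho]" X Theta] X by simp
  then have 1: "jelly (a @ Rho # Rho # Rho # ?t @ e) (act (a @ [Rho]) (Cup Rho) (?t @ e) ?V)"
    using jelly_Cup[of "a @ [Rho]" "?t @ e" ?V Rho] by simp
  have insert_left: "jelly (a @ Rho # ?r @ ?t @ e) (act (a @ [Rho]) (bentU Rho) (?t @ e) ?V)"
  proof -
    have "jelly (a @ Rho # ?r @ e) (act (a @ [Rho]) (bentU Rho) e X)"
      using IH[of "a @ [Rho]" X Rho] X by simp
    then have "jelly (a @ Rho # ?r @ ?t @ e)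
        (act (a @ Rho # ?r) (bentU Theta) e (act (a @ [Rho]) (bentU Rho) e X))"
      using IH[of "a @ Rho # ?r" _ Theta] by simp
    then show ?thesis
      using act_exchange[where c = "a @ [Rho]" and d = "[]" and e = e, OF bentU_hom bentU_hom, of Rho Theta X]
      by simp
  qed
  then have 2: "jelly (a @ Rho # Rho # Rho # ?t @ e)
      (act (a @ [Rho]) D e (act (a @ [Rho]) (bentU Rho) (?t @ e) ?V))"
    using jelly_u_free[OF D, of "a @ [Rho]" e] by simp
  have "jelly (a @ Rho # Rho # ?r @ Rho # e) (act (a @ [Rho, Rho]) (bentU Rho) (Rho # e) ?Z)"
    using *[of X "a @ [Rho]" e] jelly_states[OF X] split_span.add[OF split_span.scl[OF 1] split_span.scl[OF 2]]
    by (simp add: half_slide)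
  then show ?thesis using jelly_Cap[of a Rho "?r @ Rho # e"] eq by simp
qed

text \<open>
  After the rotation a \<open>u\<close>-type generator has two \<open>\<rho>\<close>-strands immediately to its right.  Fusing these
  two strands leaves a cup, which can be created after the insertion, or a single \<open>\<rho>\<close>-strand, which the
  preceding lemma crosses.
\<close>
lemma jelly_insert_rho_Theta:
  assumes IH: "\<And>a X s. jelly (a @ e) X \<Longrightarrow> jelly (a @ half s @ half s @ e) (act a (bentU s) e X)"
    and X: "jelly (a @ Rho # e) X"
  shows "jelly (a @ half Theta @ half Theta @ Rho # e) (act a (bentU Theta) (Rho # e) X)"
proof -
  let ?r = "half Rho @ half Rho" and ?Z = "act a (Cup Rho) (Rho # e) X"
  let ?P = "act (a @ [Rho]) (Cap Rho) e ?Z" and ?Q = "act (a @ [Rho]) GenM e ?Z"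
  obtain k where *: "act a (bentU Theta) (Rho # e) X = scl k (act a (Cap Rho) (half Theta @ half Theta @ Rho # e)
        (act (a @ [Rho]) (bentU Rho) (Rho # Rho # e) ?Z))"
    using bentU_rotation jelly_states[OF X] by metis
  have Z: "jelly (a @ Rho # Rho # Rho # e) ?Z" using jelly_Cup[OF X] by simp
  have P: "jelly (a @ Rho # e) ?P" using jelly_Cap[of "a @ [Rho]" Rho e] Z by simp
  have Q: "jelly (a @ Rho # Rho # e) ?Q"
    using jelly_u_free[OF u_free.GenM hom_GenM, of "a @ [Rho]" e] Z by simp
  have "jelly (a @ Rho # ?r @ e) (act (a @ [Rho]) (bentU Rho) e ?P)"
    using IH[of "a @ [Rho]" ?P Rho] P by simp
  then have "jelly (a @ Rho # ?r @ Rho # Rho # e)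
      (act (a @ Rho # ?r) (Cup Rho) e (act (a @ [Rho]) (bentU Rho) e ?P))"
    using jelly_Cup[of "a @ Rho # ?r" e _ Rho] by simp
  then have 1: "jelly (a @ Rho # ?r @ Rho # Rho # e)
      (act (a @ [Rho]) (bentU Rho) (Rho # Rho # e) (act (a @ [Rho]) (Cup Rho) e ?P))"
    using act_exchange[where c = "a @ [Rho]" and d = "[]" and e = e, OF bentU_hom hom_Cup, of Rho Rho ?P] by simp
  have "jelly (a @ Rho # ?r @ Rho # e) (act (a @ [Rho]) (bentU Rho) (Rho # e) ?Q)"
    using jelly_insert_rho_Rho[OF IH, of "a @ [Rho]" ?Q] Q by simp
  then have "jelly (a @ Rho # ?r @ Rho # Rho # e)
      (act (a @ Rho # ?r) GenMStar e (act (a @ [Rho]) (bentU Rho) (Rho # e) ?Q))"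
    using jelly_u_free[OF u_free.GenMStar hom_GenMStar, of "a @ Rho # ?r" e] by simp
  then have 2: "jelly (a @ Rho # ?r @ Rho # Rho # e)
      (act (a @ [Rho]) (bentU Rho) (Rho # Rho # e) (act (a @ [Rho]) GenMStar e ?Q))"
    using act_exchange[where c = "a @ [Rho]" and d = "[]" and e = e, OF bentU_hom hom_GenMStar, of Rho ?Q] by simp
  let ?U = "act (a @ [Rho]) (Cup Rho) e ?P" and ?W = "act (a @ [Rho]) GenMStar e ?Q"
  have U: "?U \<in> states ((a @ [Rho]) @ [] @ Rho # Rho # e)" and W: "?W \<in> states ((a @ [Rho]) @ [] @ Rho # Rho # e)"
    using act_states[OF hom_Cup, of ?P "a @ [Rho]" e] act_states[OF hom_GenMStar, of ?Q "a @ [Rho]" e]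
      jelly_states[OF P] jelly_states[OF Q] by simp_all
  have "?Z = add (scl (1 / \<tau>) ?U) ?W"
    using rho_fusion_act[of ?Z "a @ [Rho]" e] jelly_states[OF Z] by simp
  then have "act (a @ [Rho]) (bentU Rho) (Rho # Rho # e) ?Z
      = add (scl (1 / \<tau>) (act (a @ [Rho]) (bentU Rho) (Rho # Rho # e) ?U))
          (act (a @ [Rho]) (bentU Rho) (Rho # Rho # e) ?W)"
    using act_add[OF bentU_hom scl_states[OF U] W, of Rho "1 / \<tau>"] act_scl[OF bentU_hom U, of Rho "1 / \<tau>"]
    by metis
  then have "jelly (a @ Rho # ?r @ Rho # Rho # e) (act (a @ [Rho]) (bentU Rho) (Rho # Rho # e) ?Z)"
    using split_span.add[OF split_span.scl[OF 1] 2] by simp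
  then have "jelly (a @ Rho # Rho # half Theta @ half Theta @ Rho # e)
      (act (a @ [Rho]) (bentU Rho) (Rho # Rho # e) ?Z)" by (simp add: half_slide)
  then show ?thesis unfolding * by (intro split_span.scl jelly_Cap)
qed

lemma jelly_insert:
  "jelly (a @ e) X \<Longrightarrow> jelly (a @ half s @ half s @ e) (act a (bentU s) e X)"
proof (induction e arbitrary: a X s)
  case Nil
  then show ?case using jelly_append[of a X s] by simp
next
  case (Cons x e)
  then show ?case
    using jelly_insert_theta[of e a X s] jelly_insert_rho_Rho[of e a X] jelly_insert_rho_Theta[of e a X]
    by (cases x; cases s) simp_all
qed

section \<open>Evaluation of closed diagrams\<close>

lemma jelly_genU:
  assumes "jelly (c @ half (other s) @ e) X"
  shows "jelly (c @ half s @ e) (act c (genU s) e X)"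
proof -
  have "jelly (c @ half s @ half s @ half (other s) @ e) (act c (bentU s) (half (other s) @ e) X)"
    using jelly_insert[OF assms] .
  then show ?thesis
    using jelly_u_free[OF u_free_ev half_ev_hom, of "c @ half s" s e] genU_via_bentU[OF jelly_states[OF assms]]
    by simp
qed

lemma jelly_diagram:
  assumes "is_diagram d" "d \<in> hom n a b" "jelly (c @ a @ e) X"
  shows "jelly (c @ b @ e) (act c d e X)"
  using assms
proof (induction d arbitrary: a b c e X)
  case GenU
  then show ?case using jelly_genU[of c Theta e X] by (simp add: hom_def half_def)
next
  case GenUStar
  then show ?case using jelly_genU[of c Rho e X] by (simp add: hom_def half_def)
next
  case (Comp f g)
  from Comp.prems(2) obtain d where d: "f \<in> hom n d b" "g \<in> hom n a d" using hom_compD by blast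
  then show ?case using Comp by (simp add: act_comp)
next
  case (Tens f g)
  from Tens.prems(2) obtain a1 b1 a2 b2
    where d: "f \<in> hom n a1 b1" "g \<in> hom n a2 b2" "a = a1 @ a2" "b = b1 @ b2"
    by (auto simp: hom_def)
  then have "jelly (c @ a1 @ b2 @ e) (act (c @ a1) g e X)"
    using Tens.IH(2)[of a2 b2 "c @ a1" e X] Tens.prems by simp
  then show ?case using Tens.IH(1)[of a1 b1 c "b2 @ e"] d Tens.prems(1) by (simp add: act_tens(1))
qed (simp_all add: jelly_u_free u_free.intros)

text \<open>
  Splitting layers and links have nonempty target words, so over the empty word only the
  empty chain is left.
\<close>
lemma jelly_closed: "jelly w X \<Longrightarrow> w = [] \<Longrightarrow> \<exists>k. X = scl k vac"
proof (induction rule: split_span.induct)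
  case (base w r)
  from base.hyps show ?case
  proof cases
    case empty
    then show ?thesis using scl_one[OF vac_states] by metis
  qed (use base.prems in simp)
next
  case (zero w)
  then show ?case using zer_eq[OF vac_states] by metis
next
  case (add w X Y)
  then show ?case using add_scl[OF vac_states] by metis
next
  case (scl w X k)
  then show ?case using scl_scl[OF vac_states] by metis
qed simp

lemma closed_diagram_scalar:
  assumes "closed_diagram n d"
  shows "\<exists>c. d \<approx> c \<bullet> empty_diagram"
proof -
  have d: "is_diagram d" "d \<in> hom n [] []" using assms by (simp_all add: closed_diagram_def)
  have "jelly [] (act [] d [] vac)"
    using jelly_diagram[OF d, of "[]" "[]" vac] split_span.base[of chain "[]" vac, OF chain.empty] by simp
  then obtain k where "act [] d [] vac = scl k vac" using jelly_closed by blast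
  moreover have "act [] d [] vac = cls d"
  proof -
    have "Id [] \<otimes> d \<otimes> Id [] \<approx> Id [] \<otimes> d"
      by (rule tens_cong[OF mor_refl[OF hom_Id] tens_unit[OF d(2)]])
    also have "Id [] \<otimes> d \<approx> d" by (rule unit_tens[OF d(2)])
    finally have "act [] d [] vac = app d vac" unfolding act_def by (rule app_cong)
    also have "\<dots> = cls d"
      unfolding vac_def app_cls[OF hom_Id d(2)] by (rule cls_eqI[OF comp_id[OF d(2)]])
    finally show ?thesis .
  qed
  moreover have "scl k vac = cls (k \<bullet> empty_diagram)"
    unfolding vac_def empty_diagram_def by (rule scl_cls[OF hom_Id])
  ultimately have "cls d = cls (k \<bullet> empty_diagram)" by simp
  then show ?thesis
    using cls_eqD[OF _ hom_scale[OF hom_Id]] unfolding empty_diagram_def by blast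
qed

end

theorem theorem3p9:
  fixes n :: nat and \<omega> \<sigma> :: complex and d :: mor
  assumes "n \<ge> 1"
    and "\<omega> ^ (2 * n) = 1"
    and "\<sigma>\<^sup>2 = \<omega>"
    and "closed_diagram n d"
  shows "\<exists>c. mor_eq n \<omega> \<sigma> d (c \<bullet> empty_diagram)"
proof -
  interpret skein_category n \<omega> \<sigma> by unfold_locales (rule assms(1))
  show ?thesis by (rule closed_diagram_scalar[OF assms(4)])
qed

end
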